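(* Let $[\,\cdot\,]$ be the $\mathbb{Q}(x,t,w)$-valued invariant of colored singular links described in the context. The following local (skein) relations hold for $[\,\cdot\,]$. In each relation all diagrams are identical outside a disk, and inside the disk they are as described and contain only 4-valent vertices (singular crossings), no classical crossings; strand colors are arbitrary; "merged" means that the colors of all strands shown in the disk are identified (all components of the whole diagram having one of these colors get one common color), and otherwise the coloring is unchanged. 1. (Loop) Let $G$ contain in the disk one strand with a single self-intersection vertex, bounding one empty loop, and let $G'$ be obtained by replacing it with an embedded arc with the same endpoints. Then $$[G]=\left(\frac{w}{1-t}+\frac{w^{-1}}{1-t^{-1}}\right)[G'].$$ 2. (Parallel bigon) Let $G$ contain in the disk two upward strands meeting in exactly two vertices, bounding an empty bigon. Let $G_{\parallel}$ be obtained by replacing these by two disjoint upward strands (each with the same endpoints and color as before), $G_{\parallel}^{m}$ the same diagram with colors merged, and $G_{V}^{m}$ the diagram with two upward strands meeting in a single vertex, with colors merged. Then $$[G]=[G_{\parallel}]+(t+t^{-1})[G_{\parallel}^{m}]+(t+t^{-1})[G_{V}^{m}].$$ 3. (Antiparallel bigon) Let $G$ contain in the disk two strands, one directed upward and one directed downward, meeting in exactly two vertices, one above the other, bounding an empty bigon. Let $G_{\parallel}$ be obtained by replacing these by two disjoint vertical strands (each with the same endpoints and color as before), $G_{\parallel}^m$ the same diagram with colors merged, and $G_{\asymp}^m$ the diagram in which, instead, the two top endpoints are joined by an arc and the two bottom endpoints are joined by a disjoint arc, with colors merged. Then $$[G]=[G_{\parallel}]+(t+t^{-1}+1)[G_{\parallel}^m]+\left(\frac{wt^{-1}}{1-t}+\frac{w^{-1}t}{1-t^{-1}}\right)[G_{\asymp}^m].$$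 4. (Triangle, all strands upward) Consider three strands in the disk joining bottom points $B_1,B_2,B_3$ to top points $T_3,T_2,T_1$ respectively (numbered from left to right), all directed upward and pairwise meeting in exactly one vertex. Let $G_{121}$ be the diagram in which, read from bottom to top, the vertices occur between positions $1,2$, then $2,3$, then $1,2$; let $G_{212}$ be the one in which they occur between positions $2,3$, then $1,2$, then $2,3$. Let $G_{1}^{m}$ (resp. $G_2^m$) be the diagram with three upward strands with a single vertex, between positions $1,2$ (resp. $2,3$), and a disjoint vertical strand in the remaining position, with the colors of all three strands merged. Then $$[G_{121}]-[G_{212}]=[G_1^m]-[G_2^m].$$ 5. (Triangle, middle strand downward) Let $H_{121}$ and $H_{212}$ be as $G_{121}$ and $G_{212}$ respectively, except that the strand joining $B_2$ and $T_2$ is directed downward (from $T_2$ to $B_2$). Let $E_1^m$ be the diagram consisting of three disjoint arcs $T_2\to T_1$, $B_1\to B_2$, $B_3\to T_3$, and let $E_2^m$ be the diagram consisting of three disjoint arcs $T_2\to T_3$, $B_3\to B_2$, $B_1\to T_1$, in both cases with all colors merged. Then $$[H_{121}]-[H_{212}]=\left(\frac{wt^{-2}}{1-t}+\frac{w^{-1}t^{2}}{1-t^{-1}}\right)\left([E_1^m]-[E_2^m]\right).$$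
   Context: **Colored (singular) links.** A singular link is an immersion in $\mathbb{R}^3$ of a disjoint union of finitely many circles whose only singularities are finitely many transverse double points, considered up to rigid-vertex ambient isotopy. All links here are oriented. The components are the images of the circles (a component passes straight through each double point). A diagram is a planar projection with classical crossings and singular crossings (drawn as 4-valent vertices). A colored (singular) link is an oriented (singular) link with a coloration, i.e. a function from its set of components to a finite set of colors; colorations $\gamma,\gamma'$ are equivalent if $\gamma'=\beta\circ\gamma$ for a bijection $\beta$ between their images. An oriented, colored, 4-valent planar graph is a diagram of a colored singular link without classical crossings. **Local notation.** Fix a disk in which a diagram consists of two strands, both directed upward, with arbitrary (possibly equal) colors $a,b$. The following denote diagrams identical outside the disk. Coloring unchanged: $X_+^{a,b}$ (positive classical crossing), $X_-^{a,b}$ (negative classical crossing), $V^{a,b}$ (singular crossing). With the colors $a$ and $b$ merged, i.e. all components of the diagram with color $a$ or $b$ are given one common color: $X_+$, $X_-$, $V$ (positive, negative, singular crossing) and $I$ (two disjoint upward arcs, the oriented smoothing). **The invariant $F$.** The Aicardi–Juyumaya invariant $F$ of colored (classical) links, with values in $\mathbb{Q}(x,t,w)$, exists and is uniquely determined by: (I) $F(\text{unknot})=1$; (II) $F(D\sqcup O)=\frac{1}{wx}F(D)$, where $D\sqcup O$ is the disjoint union of $D$ with an unknotted circle whose color differs from all colors of $D$; (III) $\frac1w F(X_+^{a,b})-wF(X_-^{a,b})=\left(1-\frac1t\right)F(I)+\left(\frac1w-\frac1{tw}\right)F(X_+)$ for all $a,b$. **The invariant $[\,\cdot\,]$.** For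 a diagram $D$ of a colored classical link, $[D]=F(D)$. For diagrams with singular crossings, $[\,\cdot\,]$ is computed by applying at each singular crossing either one of the relations (S1) $[V^{a,b}]=\frac1w[X_+^{a,b}]+\frac1t[I]+\frac1{tw}[X_+]$, (S2) $[V^{a,b}]=w[X_-^{a,b}]+t[I]+tw[X_-]$, which give the same value. The resulting $[\,\cdot\,]$ is an invariant of colored singular links under ambient isotopy (and equivalence of colorations). *)

theory Defs
  imports
    Main
    "HOL-Computational_Algebra.Polynomial"
    "HOL-Computational_Algebra.Fraction_Field"
begin

section \<open>The field of rational functions in x, t, w over the rationals\<close>

text \<open>Realised as the fraction field of \<open>rat[x][t][w]\<close>.\<close>

type_synonym ratfun = "rat poly poly poly fract"

definition var_x :: ratfun (\<open>\<x>\<close>) where "\<x> = Fraction_Field.Fract [:[:[:0, 1:]:]:] 1"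
definition var_t :: ratfun (\<open>\<t>\<close>) where "\<t> = Fraction_Field.Fract [:[:0, 1:]:] 1"
definition var_w :: ratfun (\<open>\<w>\<close>) where "\<w> = Fraction_Field.Fract [:0, 1:] 1"


section \<open>Colored oriented diagrams\<close>

text \<open>
  A diagram in general position with respect to the height function is cut by horizontal lines
  into layers, each containing one elementary piece (a crossing, a local minimum \<open>Cup\<close> or
  a local maximum \<open>Cap\<close>) between vertical strands; diagrams are read from bottom to top.
  Every point of a strand on a cutting line carries the direction and the color of the strand
  there.  The typing discipline \<open>tangle\<close> makes these labels propagate along strands, straight
  through all crossings, so that a consistent labelling is precisely an orientation together
  with a function from the set of components to colors.

  In \<open>Cross k p q\<close> the strand labelled \<open>p\<close> runs (up or down) along the line from bottom left to
  top right, the strand labelled \<open>q\<close> along the line from bottom right to top left.  For \<open>Over\<close>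
  the first of them is the overpassing one, for \<open>Under\<close> the second; \<open>Sing\<close> is a double point.
\<close>

datatype dir = Up | Down

fun opp :: "dir \<Rightarrow> dir" where
  "opp Up = Down"
| "opp Down = Up"

type_synonym color = nat
type_synonym strand = "dir \<times> color"

definition flip :: "strand \<Rightarrow> strand" where
  "flip p = (opp (fst p), snd p)"

datatype kind = Over | Under | Sing

fun mirror :: "kind \<Rightarrow> kind" where
  "mirror Over = Under"
| "mirror Under = Over"
| "mirror Sing = Sing"

datatype 'a piece = Cross kind 'a 'a | Cup 'a | Cap 'a

text \<open>\<open>Cup p\<close> and \<open>Cap p\<close> carry the label of their left leg.\<close>

fun lower :: "strand piece \<Rightarrow> strand list" where
  "lower (Cross k p q) = [p, q]"
| "lower (Cup p) = []"
| "lower (Cap p) = [p, flip p]"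

fun upper :: "strand piece \<Rightarrow> strand list" where
  "upper (Cross k p q) = [q, p]"
| "upper (Cup p) = [p, flip p]"
| "upper (Cap p) = []"

type_synonym layer = "strand list \<times> strand piece \<times> strand list"
type_synonym diagram = "layer list"

fun tangle :: "strand list \<Rightarrow> diagram \<Rightarrow> strand list \<Rightarrow> bool" where
  "tangle u [] v \<longleftrightarrow> u = v"
| "tangle u ((l, g, r) # D) v \<longleftrightarrow> u = l @ lower g @ r \<and> tangle (l @ upper g @ r) D v"

definition link_diagram :: "diagram \<Rightarrow> bool" where
  "link_diagram D \<longleftrightarrow> D \<noteq> [] \<and> tangle [] D []"

definition classical :: "diagram \<Rightarrow> bool" where
  "classical D \<longleftrightarrow> (\<forall>(l, g, r) \<in> set D. \<forall>p q. g \<noteq> Cross Sing p q)"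

definition colors :: "diagram \<Rightarrow> color set" where
  "colors D = (\<Union>(l, g, r) \<in> set D. snd ` set (l @ lower g @ upper g @ r))"

definition recolor :: "(color \<Rightarrow> color) \<Rightarrow> diagram \<Rightarrow> diagram" where
  "recolor f = map (\<lambda>(l, g, r). (map (apsnd f) l, map_piece (apsnd f) g, map (apsnd f) r))"

text \<open>
  Identify the colors in the finite nonempty set \<open>A\<close>.  The common color chosen belongs to
  \<open>A\<close>, so it differs from all colors that are not merged.
\<close>

definition merge :: "color set \<Rightarrow> diagram \<Rightarrow> diagram" where
  "merge A = recolor (\<lambda>c. if c \<in> A then Min A else c)"


section \<open>Diagrams that are identical outside a disk\<close>

text \<open>
  \<open>(lo, l, r, hi)\<close> stands for the part of a diagram outside a rectangular disk: \<open>lo\<close> and \<open>hi\<close>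
  lie below and above the disk, the vertical strands \<open>l\<close> and \<open>r\<close> to its left and right.
  In \<open>merge A (plug C d)\<close> the contents \<open>d\<close> only has to fit into the disk after the colors
  have been merged.
\<close>

type_synonym outside = "diagram \<times> strand list \<times> strand list \<times> diagram"

fun plug :: "outside \<Rightarrow> diagram \<Rightarrow> diagram" where
  "plug (lo, l, r, hi) d = lo @ map (\<lambda>(l', g, r'). (l @ l', g, r' @ r)) d @ hi"

definition crossing :: "kind \<Rightarrow> strand \<Rightarrow> strand \<Rightarrow> diagram" where
  "crossing k p q = [([], Cross k p q, [])]"

text \<open>A strand with a kink, whose loop lies to the right or to the left.\<close>

definition loop_right :: "kind \<Rightarrow> strand \<Rightarrow> diagram" where
  "loop_right k p =
     [([p], Cup p, []), ([], Cross k p p, [flip p]), ([p], Cap p, [])]"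

definition loop_left :: "kind \<Rightarrow> strand \<Rightarrow> diagram" where
  "loop_left k p =
     [([], Cup (flip p), [p]), ([flip p], Cross k p p, []), ([], Cap (flip p), [p])]"

definition bigon :: "kind \<Rightarrow> kind \<Rightarrow> strand \<Rightarrow> strand \<Rightarrow> diagram" where
  "bigon k k' p q = [([], Cross k p q, []), ([], Cross k' q p, [])]"

text \<open>
  Three strands \<open>p\<close>, \<open>q\<close>, \<open>r\<close>, starting at the bottom in this order from left to right and
  pairwise crossing once; \<open>kpq\<close> is the kind of the crossing of \<open>p\<close> and \<open>q\<close>, etc.
\<close>

definition triangle_121 ::
    "kind \<Rightarrow> kind \<Rightarrow> kind \<Rightarrow> strand \<Rightarrow> strand \<Rightarrow> strand \<Rightarrow> diagram" where
  "triangle_121 kpq kpr kqr p q r =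
     [([], Cross kpq p q, [r]), ([q], Cross kpr p r, []), ([], Cross kqr q r, [p])]"

definition triangle_212 ::
    "kind \<Rightarrow> kind \<Rightarrow> kind \<Rightarrow> strand \<Rightarrow> strand \<Rightarrow> strand \<Rightarrow> diagram" where
  "triangle_212 kpq kpr kqr p q r =
     [([p], Cross kqr q r, []), ([], Cross kpr p r, [q]), ([r], Cross kpq p q, [])]"

definition circle :: "strand \<Rightarrow> diagram" where
  "circle p = [([], Cup p, []), ([], Cap p, [])]"


section \<open>Rigid-vertex ambient isotopy\<close>

text \<open>
  The moves \<open>exchange\<close> to \<open>slide_cup\<close> generate planar isotopy; \<open>R1_right\<close> to \<open>R3\<close>
  are the Reidemeister moves; \<open>R4_outer\<close> and \<open>R4_middle\<close> move a strand over or under a double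
  point; \<open>R5\<close> turns a rigid vertex over.  All of them hold for all orientations and colors.

  A strand pushed across a local maximum or minimum meets the other leg, traversed the other
  way up, which is why \<open>mirror\<close> occurs in the slides.  The condition in \<open>R3\<close> excludes the two
  patterns in which \<open>p\<close>, \<open>q\<close>, \<open>r\<close> pass over one another cyclically.
\<close>

inductive move :: "diagram \<Rightarrow> diagram \<Rightarrow> bool" where
  exchange: "move [([], g, m @ lower h), (upper g @ m, h, [])]
                  [(lower g @ m, h, []), ([], g, m @ upper h)]"
| zigzag_right: "move [([p], Cup (flip p), []), ([], Cap p, [p])] []"
| zigzag_left: "move [([], Cup p, [p]), ([p], Cap (flip p), [])] []"
| slide_cap: "move [([], Cross k p q, [flip p]), ([q], Cap p, [])]
                   [([p], Cross (mirror k) q (flip p), []), ([], Cap p, [q])]"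
| slide_cup: "move [([q], Cup p, []), ([], Cross k q p, [flip p])]
                   [([], Cup p, [q]), ([p], Cross (mirror k) (flip p) q, [])]"
| R1_right: "k \<noteq> Sing \<Longrightarrow> move (loop_right k p) []"
| R1_left: "k \<noteq> Sing \<Longrightarrow> move (loop_left k p) []"
| R2: "k \<noteq> Sing \<Longrightarrow> move (bigon k (mirror k) p q) []"
| R3: "Sing \<notin> {kpq, kpr, kqr} \<Longrightarrow> kpr \<in> {kpq, kqr} \<Longrightarrow>
       move (triangle_121 kpq kpr kqr p q r) (triangle_212 kpq kpr kqr p q r)"
| R4_outer: "k \<noteq> Sing \<Longrightarrow>
       move (triangle_121 Sing k k p q r) (triangle_212 Sing k k p q r)"
| R4_outer': "k \<noteq> Sing \<Longrightarrow>
       move (triangle_121 k k Sing p q r) (triangle_212 k k Sing p q r)"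
| R4_middle: "k \<noteq> Sing \<Longrightarrow>
       move (triangle_121 k Sing (mirror k) p q r) (triangle_212 k Sing (mirror k) p q r)"
| R5: "k \<noteq> Sing \<Longrightarrow> move (bigon Sing k p q) (bigon k Sing p q)"

inductive isotopy_step :: "diagram \<Rightarrow> diagram \<Rightarrow> bool" where
  "move d d' \<Longrightarrow> link_diagram (plug C d) \<Longrightarrow> link_diagram (plug C d') \<Longrightarrow>
   isotopy_step (plug C d) (plug C d')"

definition isotopic :: "diagram \<Rightarrow> diagram \<Rightarrow> bool" where
  "isotopic = equivclp isotopy_step"

lemma flip_flip [simp]: "flip (flip p) = p"
  by (cases p; cases "fst p") (auto simp: flip_def)

text \<open>Both sides of a move have the same end points, with the same labels.\<close>

lemma move_boundary: "move d d' \<Longrightarrow> \<exists>u v. tangle u d v \<and> tangle u d' v"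
  by (induction rule: move.induct)
    (auto simp: loop_right_def loop_left_def bigon_def triangle_121_def triangle_212_def)


section \<open>The invariants\<close>

definition isotopy_invariant :: "(diagram \<Rightarrow> bool) \<Rightarrow> (diagram \<Rightarrow> ratfun) \<Rightarrow> bool" where
  "isotopy_invariant P F \<longleftrightarrow>
     (\<forall>D D'. link_diagram D \<and> link_diagram D' \<and> P D \<and> P D' \<and> isotopic D D' \<longrightarrow> F D = F D') \<and>
     (\<forall>D f. link_diagram D \<and> P D \<and> inj_on f (colors D) \<longrightarrow> F (recolor f D) = F D)"

text \<open>
  The defining properties of the Aicardi--Juyumaya invariant.  Only the values on diagrams of
  classical links matter.  With both strands directed upward \<open>Over\<close> is the positive crossing.
\<close>

definition AJ_invariant :: "(diagram \<Rightarrow> ratfun) \<Rightarrow> bool" where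
  "AJ_invariant F \<longleftrightarrow>
     isotopy_invariant classical F \<and>
     (\<forall>p. F (circle p) = 1) \<and>
     (\<forall>D p. link_diagram D \<and> classical D \<and> snd p \<notin> colors D \<longrightarrow>
        F (D @ circle p) = 1 / (\<w> * \<x>) * F D) \<and>
     (\<forall>C a b. let Xp = plug C (crossing Over (Up, a) (Up, b));
                  Xm = plug C (crossing Under (Up, a) (Up, b));
                  I = plug C []
        in link_diagram Xp \<and> classical Xp \<longrightarrow>
           1 / \<w> * F Xp - \<w> * F Xm =
             (1 - 1 / \<t>) * F (merge {a, b} I) +
             (1 / \<w> - 1 / (\<t> * \<w>)) * F (merge {a, b} Xp))"

text \<open>\<open>B\<close> is the extension of \<open>F\<close> to diagrams of colored singular links.\<close>

definition singular_extension ::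
    "(diagram \<Rightarrow> ratfun) \<Rightarrow> (diagram \<Rightarrow> ratfun) \<Rightarrow> bool" where
  "singular_extension F B \<longleftrightarrow>
     (\<forall>D. link_diagram D \<and> classical D \<longrightarrow> B D = F D) \<and>
     isotopy_invariant (\<lambda>_. True) B \<and>
     (\<forall>C a b. let V = plug C (crossing Sing (Up, a) (Up, b));
                  Xp = plug C (crossing Over (Up, a) (Up, b));
                  Xm = plug C (crossing Under (Up, a) (Up, b));
                  I = plug C []
        in link_diagram V \<longrightarrow>
           B V = 1 / \<w> * B Xp + 1 / \<t> * B (merge {a, b} I)
                 + 1 / (\<t> * \<w>) * B (merge {a, b} Xp) \<and>
           B V = \<w> * B Xm + \<t> * B (merge {a, b} I)
                 + \<t> * \<w> * B (merge {a, b} Xm))"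

end

(*
  A singular crossing is expanded by (S1) or (S2) in such a way that the classical crossings
  obtained cancel.  In a kink (S1) and (S2) both leave the straightened strand, by a Reidemeister
  I move, and the strand together with a circle; eliminating the latter gives the loop relation.
  In a bigon the two vertices are expanded with opposite signs, which allows a Reidemeister II
  move.  In a triangle the crossing of the outer strands is expanded first, and then one of the
  two other crossings with the sign for which the third strand slides past the remaining double
  point; only diagrams with a smoothed crossing survive in the difference, and these are bigons
  or, after further slides, have all colors merged.

  (S1) and (S2) are only given for upward strands.  Turning a crossing by a quarter by means of a
  local minimum and a local maximum reverses one strand, which yields all other orientations.
*)

theory Submission
  imports Defs
begin

section \<open>Labelled tangles, disks and disks within disks\<close>

lemma dir_cases: "d \<noteq> e \<Longrightarrow> e = opp d"
  by (cases d; cases e) auto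

lemma mirror_mirror [simp]: "mirror (mirror k) = k"
  by (cases k) auto

lemma mirror_eq_Sing [simp]: "mirror k = Sing \<longleftrightarrow> k = Sing"
  by (cases k) auto

lemma tangle_append: "tangle u (D @ E) v \<longleftrightarrow> (\<exists>x. tangle u D x \<and> tangle x E v)"
  by (induction D arbitrary: u) auto

definition shift :: "strand list \<Rightarrow> strand list \<Rightarrow> diagram \<Rightarrow> diagram" where
  "shift l r = map (\<lambda>(l', g, r'). (l @ l', g, r' @ r))"

lemma shift_simps [simp]:
  "shift l r [] = []"
  "shift l r ((l', g, r') # d) = (l @ l', g, r' @ r) # shift l r d"
  "shift l r (d @ e) = shift l r d @ shift l r e"
  by (simp_all add: shift_def)

lemma shift_shift: "shift l r (shift l' r' d) = shift (l @ l') (r' @ r) d"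
  by (induction d) auto

lemma tangle_shift: "tangle u d v \<Longrightarrow> tangle (l @ u @ r) (shift l r d) (l @ v @ r)"
  by (induction u d v rule: tangle.induct) auto

text \<open>The first layer of a nonempty \<open>shift l r d\<close> shows a whole cutting line and
  so determines \<open>x\<close>; typing carries \<open>l\<close> and \<open>r\<close> unchanged to
  the top. For \<open>d = []\<close> the line \<open>x\<close> would be arbitrary.\<close>

lemma tangle_shiftD:
  assumes "tangle x (shift l r d) y" "tangle u d v" "d \<noteq> []"
  shows "x = l @ u @ r \<and> y = l @ v @ r"
  using assms
proof (induction d arbitrary: x u)
  case (Cons a d)
  obtain l' g r' where a: "a = (l', g, r')" by (cases a)
  show ?case
  proof (cases "d = []")
    case True
    then show ?thesis using Cons.prems a by auto
  next
    case False
    then show ?thesis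
      using Cons.IH[of "l @ l' @ upper g @ r' @ r" "l' @ upper g @ r'"] Cons.prems a by auto
  qed
qed simp

lemma plug_shift: "plug (lo, l, r, hi) d = lo @ shift l r d @ hi"
  by (simp add: shift_def)

declare plug.simps [simp del]

text \<open>
  \<open>lo\<close> is required to be nonempty because the empty diagram does not count as a link diagram.
\<close>

fun fits :: "outside \<Rightarrow> strand list \<Rightarrow> strand list \<Rightarrow> bool" where
  "fits (lo, l, r, hi) u v \<longleftrightarrow> lo \<noteq> [] \<and> tangle [] lo (l @ u @ r) \<and> tangle (l @ v @ r) hi []"

lemma link_diagram_plug: "fits C u v \<Longrightarrow> tangle u d v \<Longrightarrow> link_diagram (plug C d)"
  by (cases C) (auto simp: plug_shift link_diagram_def tangle_append intro: tangle_shift)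

lemma fits_plug:
  assumes "link_diagram (plug C d)" "tangle u d v" "d \<noteq> []" "u \<noteq> []"
  shows "fits C u v"
proof -
  obtain lo l r hi where C: "C = (lo, l, r, hi)" by (cases C)
  then obtain x y where "tangle [] lo x" "tangle x (shift l r d) y" "tangle y hi []"
    using assms(1) by (auto simp: plug_shift link_diagram_def tangle_append)
  moreover from this(2) have "x = l @ u @ r \<and> y = l @ v @ r"
    using tangle_shiftD assms by blast
  \<comment> \<open>\<open>lo\<close> cannot be empty: it ends in the line \<open>l @ u @ r\<close>,
    which is nonempty because \<open>u\<close> is.\<close>
  ultimately show ?thesis using C \<open>u \<noteq> []\<close> by auto
qed

text \<open>A disk inside the disk: everything around it is absorbed into the outside, so that a
  move or skein relation at one place of a larger tangle becomes one that fills a whole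
  disk.\<close>

fun sub_outside :: "outside \<Rightarrow> diagram \<Rightarrow> strand list \<Rightarrow> strand list \<Rightarrow> diagram \<Rightarrow> outside" where
  "sub_outside (lo, l, r, hi) e l' r' f = (lo @ shift l r e, l @ l', r' @ r, shift l r f @ hi)"

lemma plug_sub_outside: "plug (sub_outside C e l r f) d = plug C (e @ shift l r d @ f)"
  by (cases C) (simp add: plug_shift shift_shift)

lemma fits_sub_outside:
  assumes "fits C x y" "tangle x e (l @ u @ r)" "tangle (l @ v @ r) f y"
  shows "fits (sub_outside C e l r f) u v"
proof -
  obtain lo a b hi where C: "C = (lo, a, b, hi)" by (cases C)
  then show ?thesis
    using assms(1) tangle_shift[OF assms(2), of a b] tangle_shift[OF assms(3), of a b]
    by (auto simp: tangle_append)
qed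

section \<open>Isotopy of tangles\<close>

text \<open>\<open>isotopic\<close> compares closed diagrams only; quantifying over all outsides
  that fit gives isotopy of tangles relative to their end points.\<close>

definition tequiv :: "strand list \<Rightarrow> strand list \<Rightarrow> diagram \<Rightarrow> diagram \<Rightarrow> bool" where
  "tequiv u v d d' \<longleftrightarrow> tangle u d v \<and> tangle u d' v \<and>
     (\<forall>C. fits C u v \<longrightarrow> isotopic (plug C d) (plug C d'))"

lemma tequiv_sym: "tequiv u v d d' \<Longrightarrow> tequiv u v d' d"
  by (auto simp: tequiv_def isotopic_def intro: equivclp_sym)

lemma tequiv_trans [trans]: "tequiv u v d d' \<Longrightarrow> tequiv u v d' d'' \<Longrightarrow> tequiv u v d d''"
  unfolding tequiv_def isotopic_def by (meson equivclp_trans)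

lemma tequiv_move:
  assumes "move d d'" "tangle u d v" "tangle u d' v"
  shows "tequiv u v d d'"
  unfolding tequiv_def isotopic_def
  using assms link_diagram_plug by (auto intro!: r_into_equivclp isotopy_step.intros)

text \<open>An outside of \<open>D\<close> together with the rest of \<open>D\<close> is an outside
  of \<open>d\<close>. In the chains below, \<open>e\<close>, \<open>l\<close>, \<open>r\<close> and
  \<open>f\<close> locate the disk in which a move takes place.\<close>

lemma tequiv_step:
  assumes "tequiv u v d d'"
    and "D = e @ shift l r d @ f" "D' = e @ shift l r d' @ f"
    and "tangle x e (l @ u @ r)" "tangle (l @ v @ r) f y"
  shows "tequiv x y D D'"
  using assms fits_sub_outside[OF _ assms(4,5)]
  by (fastforce simp: tequiv_def tangle_append simp flip: plug_sub_outside intro: tangle_shift)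

lemma tequiv_exchange:
  "tequiv (lower g @ m @ lower h) (upper g @ m @ upper h)
     [([], g, m @ lower h), (upper g @ m, h, [])] [(lower g @ m, h, []), ([], g, m @ upper h)]"
  by (rule tequiv_move[OF exchange]) auto

lemma tequiv_zigzag_right: "tequiv [p] [p] [([p], Cup (flip p), []), ([], Cap p, [p])] []"
  by (rule tequiv_move[OF zigzag_right]) auto

lemma tequiv_zigzag_left: "tequiv [p] [p] [([], Cup p, [p]), ([p], Cap (flip p), [])] []"
  by (rule tequiv_move[OF zigzag_left]) auto

lemma tequiv_slide_cap:
  "tequiv [p, q, flip p] [q] [([], Cross k p q, [flip p]), ([q], Cap p, [])]
     [([p], Cross (mirror k) q (flip p), []), ([], Cap p, [q])]"
  by (rule tequiv_move[OF slide_cap]) auto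

lemma tequiv_slide_cup:
  "tequiv [q] [p, q, flip p] [([q], Cup p, []), ([], Cross k q p, [flip p])]
     [([], Cup p, [q]), ([p], Cross (mirror k) (flip p) q, [])]"
  by (rule tequiv_move[OF slide_cup]) auto

lemma tequiv_R1_right: "k \<noteq> Sing \<Longrightarrow> tequiv [p] [p] (loop_right k p) []"
  by (rule tequiv_move[OF R1_right]) (auto simp: loop_right_def)

lemma tequiv_R1_left: "k \<noteq> Sing \<Longrightarrow> tequiv [p] [p] (loop_left k p) []"
  by (rule tequiv_move[OF R1_left]) (auto simp: loop_left_def)

lemma tequiv_R2: "k \<noteq> Sing \<Longrightarrow> tequiv [p, q] [p, q] (bigon k (mirror k) p q) []"
  by (rule tequiv_move[OF R2]) (auto simp: bigon_def)

lemma tequiv_R4_outer: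
  "k \<noteq> Sing \<Longrightarrow> tequiv [p, q, r] [r, q, p] (triangle_121 Sing k k p q r) (triangle_212 Sing k k p q r)"
  by (rule tequiv_move[OF R4_outer]) (auto simp: triangle_121_def triangle_212_def)

text \<open>A zigzag is put into the strand \<open>p\<close> above the crossing, its minimum moves
  down past the crossing, and its maximum slides across \<open>q\<close>. The crossing reappears
  turned by a quarter, between \<open>q\<close> and the reversed \<open>p\<close>.\<close>

lemma tequiv_rotate:
  "tequiv [p, q] [q, p] [([], Cross k p q, [])]
     [([p, q], Cup (flip p), []), ([p], Cross (mirror k) q (flip p), [p]), ([], Cap p, [q, p])]"
proof -
  have "tequiv [p, q] [q, p] [([], Cross k p q, [])]
     [([], Cross k p q, []), ([q, p], Cup (flip p), []), ([q], Cap p, [p])]"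
    by (rule tequiv_step[OF tequiv_sym[OF tequiv_zigzag_right[of p]],
          where e = "[([], Cross k p q, [])]" and l = "[q]" and r = "[]" and f = "[]"]) auto
  also have "tequiv [p, q] [q, p] \<dots>
     [([p, q], Cup (flip p), []), ([], Cross k p q, [flip p, p]), ([q], Cap p, [p])]"
    by (rule tequiv_step[OF tequiv_exchange[of "Cross k p q" "[]" "Cup (flip p)"],
          where e = "[]" and l = "[]" and r = "[]" and f = "[([q], Cap p, [p])]"]) auto
  also have "tequiv [p, q] [q, p] \<dots>
     [([p, q], Cup (flip p), []), ([p], Cross (mirror k) q (flip p), [p]), ([], Cap p, [q, p])]"
    by (rule tequiv_step[OF tequiv_slide_cap[of p q k],
          where e = "[([p, q], Cup (flip p), [])]" and l = "[]" and r = "[p]" and f = "[]"]) auto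
  finally show ?thesis .
qed

text \<open>The quarter turn of the antiparallel smoothing consists of two zigzags; straightening
  them leaves the parallel smoothing.\<close>

lemma tequiv_rotate_turn:
  "tequiv [p, p] [p, p]
     [([p, p], Cup (flip p), []), ([p], Cap p, [p]), ([p], Cup (flip p), [p]), ([], Cap p, [p, p])] []"
proof -
  have "tequiv [p, p] [p, p]
     [([p, p], Cup (flip p), []), ([p], Cap p, [p]), ([p], Cup (flip p), [p]), ([], Cap p, [p, p])]
     [([p], Cup (flip p), [p]), ([], Cap p, [p, p])]"
    by (rule tequiv_step[OF tequiv_zigzag_right[of p],
          where e = "[]" and l = "[p]" and r = "[]"]) auto
  also have "tequiv [p, p] [p, p] \<dots> []"
    by (rule tequiv_step[OF tequiv_zigzag_right[of p],
          where e = "[]" and l = "[]" and r = "[p]" and f = "[]"]) auto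
  finally show ?thesis .
qed

text \<open>Conversely, the quarter turn of the parallel smoothing is a minimum on the right and a
  maximum on the left, which only exchange heights.\<close>

lemma tequiv_rotate_parallel:
  "tequiv [p, flip p] [flip p, p]
     [([p, flip p], Cup (flip p), []), ([], Cap p, [flip p, p])] [([], Cap p, []), ([], Cup (flip p), [])]"
  by (rule tequiv_step[OF tequiv_sym[OF tequiv_exchange[of "Cap p" "[]" "Cup (flip p)"]],
        where e = "[]" and l = "[]" and r = "[]" and f = "[]"]) auto

text \<open>A crossing between the legs of a minimum is a kink in disguise: a zigzag is put into the
  left leg at the top, its minimum sinks to the bottom, and its maximum slides across the other
  strand. Slides work for every \<open>k\<close>, so double points are included.\<close>

lemma tequiv_twisted_cup:
  "tequiv [] [flip p, p] [([], Cup p, []), ([], Cross (mirror k) p (flip p), [])]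
     (([], Cup (flip p), []) # shift [flip p] [] (loop_right k p))"
proof -
  let ?X = "Cross (mirror k) p (flip p)"
  have "tequiv [] [flip p, p] [([], Cup p, []), ([], ?X, [])]
     [([], Cup p, []), ([], ?X, []), ([], Cup (flip p), [flip p, p]), ([flip p], Cap p, [p])]"
    by (rule tequiv_step[OF tequiv_sym[OF tequiv_zigzag_left[of "flip p"]],
          where e = "[([], Cup p, []), ([], ?X, [])]" and l = "[]" and r = "[p]" and f = "[]"]) auto
  also have "tequiv [] [flip p, p] \<dots>
     [([], Cup p, []), ([], Cup (flip p), [p, flip p]), ([flip p, p], ?X, []), ([flip p], Cap p, [p])]"
    by (rule tequiv_step[OF tequiv_sym[OF tequiv_exchange[of "Cup (flip p)" "[]" ?X]],
          where e = "[([], Cup p, [])]" and l = "[]" and r = "[]" and f = "[([flip p], Cap p, [p])]"]) auto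
  also have "tequiv [] [flip p, p] \<dots>
     [([], Cup (flip p), []), ([flip p, p], Cup p, []), ([flip p, p], ?X, []), ([flip p], Cap p, [p])]"
    by (rule tequiv_step[OF tequiv_sym[OF tequiv_exchange[of "Cup (flip p)" "[]" "Cup p"]],
          where e = "[]" and l = "[]" and r = "[]" and f = "[([flip p, p], ?X, []), ([flip p], Cap p, [p])]"]) auto
  also have "tequiv [] [flip p, p] \<dots> (([], Cup (flip p), []) # shift [flip p] [] (loop_right k p))"
    by (rule tequiv_step[OF tequiv_sym[OF tequiv_slide_cap[of p p k]],
          where e = "[([], Cup (flip p), []), ([flip p, p], Cup p, [])]" and l = "[flip p]" and r = "[]" and f = "[]"])
      (auto simp: loop_right_def)
  finally show ?thesis .
qed

text \<open>The upside-down counterpart: the zigzag goes into the right leg below the crossing, its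
  maximum rises to the top, and its minimum slides.\<close>

lemma tequiv_twisted_cap:
  "tequiv [p, flip p] [] [([], Cross (mirror k) p (flip p), []), ([], Cap (flip p), [])]
     (shift [] [flip p] (loop_left k p) @ [([], Cap p, [])])"
proof -
  let ?X = "Cross (mirror k) p (flip p)"
  have "tequiv [p, flip p] [] [([], ?X, []), ([], Cap (flip p), [])]
     [([p], Cup (flip p), [flip p]), ([p, flip p], Cap p, []), ([], ?X, []), ([], Cap (flip p), [])]"
    by (rule tequiv_step[OF tequiv_sym[OF tequiv_zigzag_left[of "flip p"]],
          where e = "[]" and l = "[p]" and r = "[]" and f = "[([], ?X, []), ([], Cap (flip p), [])]"]) auto
  also have "tequiv [p, flip p] [] \<dots>
     [([p], Cup (flip p), [flip p]), ([], ?X, [p, flip p]), ([flip p, p], Cap p, []), ([], Cap (flip p), [])]"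
    by (rule tequiv_step[OF tequiv_sym[OF tequiv_exchange[of ?X "[]" "Cap p"]],
          where e = "[([p], Cup (flip p), [flip p])]" and l = "[]" and r = "[]"
            and f = "[([], Cap (flip p), [])]"]) auto
  also have "tequiv [p, flip p] [] \<dots>
     [([p], Cup (flip p), [flip p]), ([], ?X, [p, flip p]), ([], Cap (flip p), [p, flip p]), ([], Cap p, [])]"
    by (rule tequiv_step[OF tequiv_sym[OF tequiv_exchange[of "Cap (flip p)" "[]" "Cap p"]],
          where e = "[([p], Cup (flip p), [flip p]), ([], ?X, [p, flip p])]" and l = "[]" and r = "[]"
            and f = "[]"]) auto
  also have "tequiv [p, flip p] [] \<dots> (shift [] [flip p] (loop_left k p) @ [([], Cap p, [])])"
    by (rule tequiv_step[OF tequiv_slide_cup[of p "flip p" "mirror k"],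
          where e = "[]" and l = "[]" and r = "[flip p]"
            and f = "[([], Cap (flip p), [p, flip p]), ([], Cap p, [])]"])
      (auto simp: loop_left_def)
  finally show ?thesis .
qed

lemma tequiv_twisted_cap_classical:
  assumes "k \<noteq> Sing"
  shows "tequiv [p, flip p] [] [([], Cross k p (flip p), []), ([], Cap (flip p), [])] [([], Cap p, [])]"
proof -
  have "tequiv [p, flip p] [] [([], Cross k p (flip p), []), ([], Cap (flip p), [])]
     (shift [] [flip p] (loop_left (mirror k) p) @ [([], Cap p, [])])"
    using tequiv_twisted_cap[of p "mirror k"] by simp
  also have "tequiv [p, flip p] [] \<dots> [([], Cap p, [])]"
    by (rule tequiv_step[OF tequiv_R1_left[of "mirror k" p],
          where e = "[]" and l = "[]" and r = "[flip p]"]) (use assms in auto)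
  finally show ?thesis .
qed

text \<open>The strand \<open>p\<close> passes both legs of the maximum on the same side. One slide
  moves its second crossing to the left leg, where it cancels the first by a Reidemeister II
  move.\<close>

lemma tequiv_over_cap:
  assumes "k \<noteq> Sing"
  shows "tequiv [p, q, flip q] [p]
    [([], Cross k p q, [flip q]), ([q], Cross k p (flip q), []), ([], Cap q, [p])] [([p], Cap q, [])]"
proof -
  have "tequiv [p, q, flip q] [p]
    [([], Cross k p q, [flip q]), ([q], Cross k p (flip q), []), ([], Cap q, [p])]
    [([], Cross k p q, [flip q]), ([], Cross (mirror k) q p, [flip q]), ([p], Cap q, [])]"
    by (rule tequiv_step[OF tequiv_sym[OF tequiv_slide_cap[of q p "mirror k"]],
          where e = "[([], Cross k p q, [flip q])]" and l = "[]" and r = "[]" and f = "[]"]) auto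
  also have "tequiv [p, q, flip q] [p] \<dots> [([p], Cap q, [])]"
    by (rule tequiv_step[OF tequiv_R2[of k p q],
          where e = "[]" and l = "[]" and r = "[flip q]" and f = "[([p], Cap q, [])]"])
      (use assms in \<open>auto simp: bigon_def\<close>)
  finally show ?thesis .
qed

lemma tequiv_over_cup:
  assumes "k \<noteq> Sing"
  shows "tequiv [p] [q, flip q, p]
    [([p], Cup q, []), ([], Cross k p q, [flip q]), ([q], Cross k p (flip q), [])] [([], Cup q, [p])]"
proof -
  have "tequiv [p] [q, flip q, p]
    [([p], Cup q, []), ([], Cross k p q, [flip q]), ([q], Cross k p (flip q), [])]
    [([], Cup q, [p]), ([q], Cross (mirror k) (flip q) p, []), ([q], Cross k p (flip q), [])]"
    by (rule tequiv_step[OF tequiv_slide_cup[of p q k],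
          where e = "[]" and l = "[]" and r = "[]" and f = "[([q], Cross k p (flip q), [])]"]) auto
  also have "tequiv [p] [q, flip q, p] \<dots> [([], Cup q, [p])]"
    by (rule tequiv_step[OF tequiv_R2[of "mirror k" "flip q" p],
          where e = "[([], Cup q, [p])]" and l = "[q]" and r = "[]" and f = "[]"])
      (use assms in \<open>auto simp: bigon_def\<close>)
  finally show ?thesis .
qed

section \<open>Merging colors\<close>

definition merge_color :: "color set \<Rightarrow> color \<Rightarrow> color" where
  "merge_color A c = (if c \<in> A then Min A else c)"

lemma merge_eq_recolor: "merge A = recolor (merge_color A)"
  by (simp add: merge_def merge_color_def [abs_def])

lemma recolor_simps [simp]:
  "recolor f [] = []"
  "recolor f ((l, g, r) # d) =
     (map (apsnd f) l, map_piece (apsnd f) g, map (apsnd f) r) # recolor f d"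
  "recolor f (d @ e) = recolor f d @ recolor f e"
  by (simp_all add: recolor_def)

lemma recolor_recolor: "recolor f (recolor g d) = recolor (f \<circ> g) d"
proof -
  have "apsnd f \<circ> apsnd g = (apsnd (f \<circ> g) :: strand \<Rightarrow> strand)"
    by auto
  then show ?thesis
    by (induction d) (simp_all add: piece.map_comp prod.case_eq_if recolor_def)
qed

lemma recolor_id: "recolor (\<lambda>c. c) d = d"
proof -
  have "apsnd (\<lambda>c. c) = (id :: strand \<Rightarrow> strand)"
    by auto
  then show ?thesis
    by (induction d) (auto simp: piece.map_id)
qed

lemma merge_color_mem [simp]: "c \<in> A \<Longrightarrow> merge_color A c = Min A"
  by (simp add: merge_color_def)

lemma merge_Nil [simp]: "merge A [] = []"
  by (simp add: merge_eq_recolor)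

lemma merge_Cons [simp]: "merge A ((l, g, r) # d) =
   (map (apsnd (merge_color A)) l, map_piece (apsnd (merge_color A)) g,
    map (apsnd (merge_color A)) r) # merge A d"
  by (simp add: merge_eq_recolor)

lemma merge_append: "merge A (d @ e) = merge A d @ merge A e"
  by (simp add: merge_eq_recolor)

lemma merge_singleton [simp]: "merge {a} d = d"
proof -
  have "merge_color {a} = (\<lambda>c. c)"
    by (auto simp: merge_color_def)
  then show ?thesis by (simp add: merge_eq_recolor recolor_id)
qed

text \<open>Since \<open>A\<close> and \<open>B\<close> meet, the image of \<open>B\<close> under
  the first merging contains \<open>Min A\<close>, which represents all of \<open>A\<close>. Its
  minimum is therefore \<open>Min (A \<union> B)\<close>, and the two mergings amount to
  one.\<close>

lemma merge_merge:
  assumes "finite A" "finite B" "A \<inter> B \<noteq> {}"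
  shows "merge (merge_color A ` B) (merge A d) = merge (A \<union> B) d"
proof -
  have "Min A \<in> A"
    using assms by (intro Min_in) auto
  have "Min (merge_color A ` B) = Min (A \<union> B)"
  proof -
    have ne: "A \<noteq> {}" using assms by auto
    have eq: "merge_color A ` B = insert (Min A) (B - A)"
      using assms by (auto simp: merge_color_def image_iff)
    have AB: "A \<union> B = A \<union> (B - A)" by auto
    show ?thesis
    proof (cases "B - A = {}")
      case True
      then have "A \<union> B = A" by auto
      then show ?thesis unfolding eq True by simp
    next
      case False
      then show ?thesis unfolding eq AB using assms ne by (subst Min_Un) auto
    qed
  qed
  moreover have "merge_color A c \<in> merge_color A ` B \<longleftrightarrow> c \<in> A \<union> B" for c
    using assms \<open>Min A \<in> A\<close> by (auto simp: merge_color_def image_iff split: if_splits)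
  ultimately have "merge_color (merge_color A ` B) \<circ> merge_color A = merge_color (A \<union> B)"
    by (intro ext) (auto simp: merge_color_def image_iff)
  then show ?thesis by (simp add: merge_eq_recolor recolor_recolor)
qed

lemma fst_flip [simp]: "fst (flip p) = opp (fst p)"
  and snd_flip [simp]: "snd (flip p) = snd p"
  by (simp_all add: flip_def)

lemma opp_opp [simp]: "opp (opp d) = d"
  by (cases d) auto

lemma flip_Pair [simp]: "flip (d, a) = (opp d, a)"
  by (simp add: flip_def)

lemma flip_apsnd [simp]: "flip (apsnd f p) = apsnd f (flip p)"
  by (cases p) simp

lemma lower_map_piece [simp]: "lower (map_piece (apsnd f) g) = map (apsnd f) (lower g)"
  and upper_map_piece [simp]: "upper (map_piece (apsnd f) g) = map (apsnd f) (upper g)"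
  by (cases g; simp)+

lemma tangle_recolor:
  "tangle u d v \<Longrightarrow> tangle (map (apsnd f) u) (recolor f d) (map (apsnd f) v)"
  by (induction u d v rule: tangle.induct) auto

text \<open>Merging is global and recolors the outside too. With the recolored outside, skein
  relations can be applied again after a merging.\<close>

fun merge_outside :: "color set \<Rightarrow> outside \<Rightarrow> outside" where
  "merge_outside A (lo, l, r, hi) =
     (merge A lo, map (apsnd (merge_color A)) l, map (apsnd (merge_color A)) r, merge A hi)"

lemma merge_shift:
  "merge A (shift l r d) =
     shift (map (apsnd (merge_color A)) l) (map (apsnd (merge_color A)) r) (merge A d)"
  unfolding merge_eq_recolor by (induction d) auto

lemma merge_plug: "merge A (plug C d) = plug (merge_outside A C) (merge A d)"
  by (cases C) (simp add: plug_shift merge_append merge_shift)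

lemma merge_merge_plug:
  assumes "finite A" "finite A'" "A \<inter> A' \<noteq> {}"
  shows "merge (merge_color A ` A') (plug (merge_outside A C) (merge A d)) =
    merge (A \<union> A') (plug C d)"
  using merge_merge[OF assms, of "plug C d"] by (simp add: merge_plug)

lemma fits_merge:
  "fits C u v \<Longrightarrow>
   fits (merge_outside A C) (map (apsnd (merge_color A)) u) (map (apsnd (merge_color A)) v)"
proof -
  obtain lo l r hi where C: "C = (lo, l, r, hi)" by (cases C)
  assume "fits C u v"
  then show ?thesis
    using tangle_recolor[of "[]" lo "l @ u @ r" "merge_color A"]
      tangle_recolor[of "l @ v @ r" hi "[]" "merge_color A"]
    by (auto simp: C merge_eq_recolor recolor_def)
qed

section \<open>The skein relation for all orientations\<close>

lemma var_t_simps [simp]: "\<t> \<noteq> 0" "\<t> \<noteq> 1" "1 + \<t> \<noteq> 0"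
  and var_w_simps [simp]: "\<w> \<noteq> 0"
  by (simp_all add: var_t_def var_w_def Zero_fract_def One_fract_def eq_fract one_pCons)

text \<open>The first skein relation (S1) belongs to the sign \<open>Over\<close>, the second (S2) to \<open>Under\<close>.\<close>

fun coeff_w :: "kind \<Rightarrow> ratfun" where
  "coeff_w Under = \<w>"
| "coeff_w _ = inverse \<w>"

fun coeff_t :: "kind \<Rightarrow> ratfun" where
  "coeff_t Under = \<t>"
| "coeff_t _ = inverse \<t>"

text \<open>As a sign, \<open>Over\<close> stands for positive and \<open>Under\<close> for
  negative; reversing exactly one strand changes the sign.\<close>

definition crossing_sign :: "kind \<Rightarrow> strand \<Rightarrow> strand \<Rightarrow> kind" where
  "crossing_sign k p q = (if fst p = fst q then k else mirror k)"

text \<open>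
  For differently colored strands \<open>smoothing p q\<close> becomes a tangle from \<open>[p, q]\<close> to \<open>[q, p]\<close>
  only after their colors have been merged.
\<close>

definition smoothing :: "strand \<Rightarrow> strand \<Rightarrow> diagram" where
  "smoothing p q = (if fst p = fst q then [] else [([], Cap p, []), ([], Cup (flip p), [])])"

lemma merge_smoothing:
  "merge A (smoothing p q) = smoothing (apsnd (merge_color A) p) (apsnd (merge_color A) q)"
  by (simp add: smoothing_def merge_eq_recolor)

text \<open>\<open>L1\<close> and \<open>L2\<close> are the expansions of a kink by (S1) and (S2):
  \<open>A\<close> is the value of the straightened strand, \<open>Y\<close> that of the strand with
  a circle, which is to be eliminated.\<close>

lemma (in field) loop_coefficient:
  assumes "t \<noteq> 0" "t \<noteq> 1" "1 + t \<noteq> 0" "w \<noteq> 0"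
    and L1: "L = inverse w * (1 + inverse t) * A + inverse t * Y"
    and L2: "L = w * (1 + t) * A + t * Y"
  shows "L = (w / (1 - t) + inverse w / (1 - inverse t)) * A"
proof -
  \<comment> \<open>This factor gives \<open>Y\<close> the coefficient \<open>w * t\<close>, the
    same as in \<open>w\<close> times the second expansion; subtracting removes \<open>Y\<close> and
    leaves the common factor \<open>1 + t\<close>.\<close>
  have "w * t * t * L = t * (1 + t) * A + w * t * Y"
    unfolding L1 using assms(1,4) by (simp add: field_simps)
  then have "w * t * t * L - w * L = (t - w * w) * (1 + t) * A"
    using arg_cong[OF L2, of "\<lambda>z. w * z"] by (simp add: algebra_simps)
  then have "(1 + t) * (w * (t - 1) * L) = (1 + t) * ((t - w * w) * A)"
    by (simp add: algebra_simps)
  then have *: "w * (t - 1) * L = (t - w * w) * A"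
    using assms(3) by simp
  have "1 - inverse t = (t - 1) / t"
    using assms(1) by (simp add: field_simps)
  then have "(w / (1 - t) + inverse w / (1 - inverse t)) * A = (t - w * w) * A / (w * (t - 1))"
    using assms(1,2,4) by (simp add: divide_simps) (simp add: algebra_simps)
  then show ?thesis
    unfolding *[symmetric] using assms(2,4) by simp
qed

text \<open>(S1) and (S2) become one formula in the kind \<open>k\<close>, so that the sign of an
  expansion can be chosen or varied.\<close>

locale singular_skein =
  fixes B :: "diagram \<Rightarrow> ratfun"
  assumes isotopic_eq: "link_diagram D \<Longrightarrow> link_diagram D' \<Longrightarrow> isotopic D D' \<Longrightarrow> B D = B D'"
    and skein_up: "k \<noteq> Sing \<Longrightarrow> link_diagram (plug C (crossing Sing (Up, a) (Up, b))) \<Longrightarrow>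
      B (plug C (crossing Sing (Up, a) (Up, b))) =
        coeff_w k * B (plug C (crossing k (Up, a) (Up, b)))
        + coeff_t k * (B (merge {a, b} (plug C []))
          + coeff_w k * B (merge {a, b} (plug C (crossing k (Up, a) (Up, b)))))"
begin

lemma tequiv_eq: "tequiv u v d d' \<Longrightarrow> fits C u v \<Longrightarrow> B (plug C d) = B (plug C d')"
  using isotopic_eq link_diagram_plug unfolding tequiv_def by blast

lemma tequiv_merge_eq:
  assumes "tequiv (map (apsnd (merge_color A)) u) (map (apsnd (merge_color A)) v) (merge A d) (merge A d')"
    and "fits C u v"
  shows "B (merge A (plug C d)) = B (merge A (plug C d'))"
  using assms tequiv_eq fits_merge merge_plug by simp

text \<open>The coefficients follow the sign rather than the kind \<open>k\<close>, which makes the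
  formula stable under quarter turns; as a predicate of the labels it can be passed from one
  orientation to the next.\<close>

definition skein_relation :: "strand \<Rightarrow> strand \<Rightarrow> bool" where
  "skein_relation p q \<longleftrightarrow> (\<forall>C k. k \<noteq> Sing \<longrightarrow> fits C [p, q] [q, p] \<longrightarrow>
      B (plug C (crossing Sing p q)) =
        coeff_w (crossing_sign k p q) * B (plug C (crossing k p q))
        + coeff_t (crossing_sign k p q) * (B (merge {snd p, snd q} (plug C (smoothing p q)))
          + coeff_w (crossing_sign k p q) * B (merge {snd p, snd q} (plug C (crossing k p q)))))"

text \<open>Each diagram in the relation for \<open>p\<close> and \<open>q\<close> is isotopic,
  after merging where needed, to the corresponding one for \<open>q\<close> and the reversed
  \<open>p\<close> in the smaller disk \<open>C'\<close>, whose outside has absorbed the minimum and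
  the maximum.\<close>

lemma skein_relation_rotate:
  assumes "skein_relation q (flip p)"
  shows "skein_relation p q"
  unfolding skein_relation_def
proof (intro allI impI)
  fix C k
  assume k: "k \<noteq> Sing" and C: "fits C [p, q] [q, p]"
  define A where "A = {snd p, snd q}"
  define p' q' where "p' = apsnd (merge_color A) p" and "q' = apsnd (merge_color A) q"
  define C' where "C' = sub_outside C [([p, q], Cup (flip p), [])] [p] [p] [([], Cap p, [q, p])]"
  have C': "fits C' [q, flip p] [flip p, q]"
    unfolding C'_def by (rule fits_sub_outside[OF C]) auto
  have plug_C': "plug C' d = plug C ([([p, q], Cup (flip p), [])] @ shift [p] [p] d @ [([], Cap p, [q, p])])" for d
    by (simp add: C'_def plug_sub_outside)
  have rotate: "B (plug C (crossing k p q)) = B (plug C' (crossing (mirror k) q (flip p)))" for k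
    using tequiv_eq[OF tequiv_rotate C, of k] by (simp add: plug_C' crossing_def)
  have rotate_merge: "B (merge A (plug C (crossing k p q))) = B (merge A (plug C' (crossing (mirror k) q (flip p))))"
    unfolding plug_C'
    by (rule tequiv_merge_eq[OF _ C]) (use tequiv_rotate[of p' q' k] in \<open>simp add: p'_def q'_def crossing_def\<close>)
  \<comment> \<open>After merging, the labels differ at most in direction, so the smoothings are
    well typed and two cases remain.\<close>
  have snd: "snd p' = snd q'"
    by (simp add: p'_def q'_def A_def merge_color_def)
  have smoothing': "tequiv [p', q'] [q', p'] (smoothing p' q')
    ([([p', q'], Cup (flip p'), [])] @ shift [p'] [p'] (smoothing q' (flip p')) @ [([], Cap p', [q', p'])])"
  proof (cases "fst p' = fst q'")
    case True
    then have "q' = p'" using snd by (simp add: prod_eq_iff)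
    moreover have "fst p' \<noteq> opp (fst p')" by (cases "fst p'") auto
    ultimately show ?thesis
      using tequiv_sym[OF tequiv_rotate_turn[of p']] by (simp add: smoothing_def)
  next
    case False
    then have "q' = flip p'" using snd dir_cases by (simp add: prod_eq_iff)
    then show ?thesis
      using tequiv_sym[OF tequiv_rotate_parallel[of p']] False by (simp add: smoothing_def)
  qed
  have smooth: "B (merge A (plug C (smoothing p q))) = B (merge A (plug C' (smoothing q (flip p))))"
    unfolding plug_C'
    by (rule tequiv_merge_eq[OF _ C])
      (use smoothing' in \<open>simp add: p'_def q'_def merge_smoothing merge_append merge_shift\<close>)
  \<comment> \<open>Mirroring the kind and reversing one strand cancel, so the coefficients
    agree.\<close>
  have sign: "crossing_sign (mirror k) q (flip p) = crossing_sign k p q"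
    by (cases "fst p"; cases "fst q") (auto simp: crossing_sign_def)
  have "{snd q, snd (flip p)} = A" by (auto simp: A_def)
  then have "B (plug C' (crossing Sing q (flip p))) =
      coeff_w (crossing_sign k p q) * B (plug C' (crossing (mirror k) q (flip p)))
      + coeff_t (crossing_sign k p q) * (B (merge A (plug C' (smoothing q (flip p))))
        + coeff_w (crossing_sign k p q) * B (merge A (plug C' (crossing (mirror k) q (flip p)))))"
    using assms[unfolded skein_relation_def, rule_format, of "mirror k" C'] C' k
    by (simp add: sign)
  then show "B (plug C (crossing Sing p q)) =
      coeff_w (crossing_sign k p q) * B (plug C (crossing k p q))
      + coeff_t (crossing_sign k p q) * (B (merge {snd p, snd q} (plug C (smoothing p q)))
        + coeff_w (crossing_sign k p q) * B (merge {snd p, snd q} (plug C (crossing k p q))))"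
    unfolding A_def[symmetric] rotate rotate_merge smooth by simp
qed

lemma skein_relation: "skein_relation p q"
proof -
  have up: "skein_relation (Up, a) (Up, b)" for a b
    unfolding skein_relation_def crossing_sign_def smoothing_def
    using skein_up link_diagram_plug by (auto simp: crossing_def)
  \<comment> \<open>Three successive quarter turns lead from two upward strands through all
    remaining orientations.\<close>
  have down_up: "skein_relation (Down, a) (Up, b)" for a b
    by (rule skein_relation_rotate) (simp add: up)
  have down: "skein_relation (Down, a) (Down, b)" for a b
    by (rule skein_relation_rotate) (simp add: down_up)
  have up_down: "skein_relation (Up, a) (Down, b)" for a b
    by (rule skein_relation_rotate) (simp add: down)
  show ?thesis
    by (cases p; cases q; cases "fst p"; cases "fst q") (simp_all add: up down_up down up_down)
qed

lemma skein:
  assumes "k \<noteq> Sing" "s = crossing_sign k p q" "fits C x y"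
    and "tangle x e (l @ [p, q] @ r)" "tangle (l @ [q, p] @ r) f y"
  shows "B (plug C (e @ (l, Cross Sing p q, r) # f)) =
    coeff_w s * B (plug C (e @ (l, Cross k p q, r) # f))
    + coeff_t s * (B (merge {snd p, snd q} (plug C (e @ shift l r (smoothing p q) @ f)))
      + coeff_w s * B (merge {snd p, snd q} (plug C (e @ (l, Cross k p q, r) # f))))"
proof -
  have "fits (sub_outside C e l r f) [p, q] [q, p]"
    using fits_sub_outside assms by blast
  from skein_relation[of p q, unfolded skein_relation_def, rule_format, OF assms(1) this]
  show ?thesis
    using assms(2) by (simp add: plug_sub_outside crossing_def)
qed

text \<open>Merging a single color changes nothing, so the two terms with a classical crossing
  combine.\<close>

lemma skein_mono:
  assumes "k \<noteq> Sing" "s = crossing_sign k p q" "fits C x y" "snd q = snd p"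
    and "tangle x e (l @ [p, q] @ r)" "tangle (l @ [q, p] @ r) f y"
  shows "B (plug C (e @ (l, Cross Sing p q, r) # f)) =
    coeff_w s * (1 + coeff_t s) * B (plug C (e @ (l, Cross k p q, r) # f))
    + coeff_t s * B (plug C (e @ shift l r (smoothing p q) @ f))"
  using skein[OF assms(1-3,5,6)] assms(4) by (simp add: algebra_simps)

section \<open>Kinks and bigons\<close>

abbreviation "loop_value \<equiv> \<w> / (1 - \<t>) + inverse \<w> / (1 - inverse \<t>)"

lemma loop_right:
  assumes C: "fits C [p] [p]"
  shows "B (plug C (loop_right Sing p)) = loop_value * B (plug C [])"
proof -
  \<comment> \<open>The oriented smoothing of the kink leaves the strand and a circle, with unknown
    value \<open>Y\<close>.\<close>
  define Y where "Y = B (plug C [([p], Cup p, []), ([p], Cap p, [])])"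
  have "B (plug C (loop_right Sing p)) =
      coeff_w k * (1 + coeff_t k) * B (plug C []) + coeff_t k * Y" if k: "k \<noteq> Sing" for k
    using skein_mono[OF k refl C refl, of "[([p], Cup p, [])]" "[]" p "[flip p]" "[([p], Cap p, [])]"]
      tequiv_eq[OF tequiv_R1_right[OF k] C]
    by (simp add: loop_right_def Y_def crossing_sign_def smoothing_def)
  from this[of Over] this[of Under] show ?thesis
    by (intro loop_coefficient) auto
qed

lemma loop_left:
  assumes C: "fits C [p] [p]"
  shows "B (plug C (loop_left Sing p)) = loop_value * B (plug C [])"
proof -
  define Y where "Y = B (plug C [([], Cup (flip p), [p]), ([], Cap (flip p), [p])])"
  have "B (plug C (loop_left Sing p)) =
      coeff_w k * (1 + coeff_t k) * B (plug C []) + coeff_t k * Y" if k: "k \<noteq> Sing" for k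
    using skein_mono[OF k refl C refl, of "[([], Cup (flip p), [p])]" "[flip p]" p "[]" "[([], Cap (flip p), [p])]"]
      tequiv_eq[OF tequiv_R1_left[OF k] C]
    by (simp add: loop_left_def Y_def crossing_sign_def smoothing_def)
  from this[of Over] this[of Under] show ?thesis
    by (intro loop_coefficient) auto
qed

lemma R2_eq:
  assumes "k \<noteq> Sing" "fits C [p, q] [p, q]"
  shows "B (plug C [([], Cross k p q, []), ([], Cross (mirror k) q p, [])]) = B (plug C [])"
  using tequiv_eq[OF tequiv_R2[OF assms(1)] assms(2)] by (simp add: bigon_def)

lemma bigon_parallel:
  fixes C d a b
  defines "p \<equiv> (d, a)" and "q \<equiv> (d, b)"
  assumes C: "fits C [p, q] [p, q]"
  shows "B (plug C (bigon Sing Sing p q)) = B (plug C [])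
    + (\<t> + inverse \<t>) * B (merge {a, b} (plug C []))
    + (\<t> + inverse \<t>) * B (merge {a, b} (plug C (crossing Sing p q)))"
proof -
  define C' m where "C' = merge_outside {a, b} C" and "m = (d, Min {a, b})"
  have C': "fits C' [m, m] [m, m]"
    using fits_merge[OF C, of "{a, b}"] by (simp add: C'_def m_def p_def q_def)
  have 1: "B (plug C (bigon Sing Sing p q)) =
      inverse \<w> * B (plug C [([], Cross Over p q, []), ([], Cross Sing q p, [])])
      + inverse \<t> * (B (plug C' [([], Cross Sing m m, [])])
        + inverse \<w> * B (plug C' [([], Cross Over m m, []), ([], Cross Sing m m, [])]))"
    using skein[of Over _ p q, OF _ refl C, of "[]" "[]" "[]" "[([], Cross Sing q p, [])]"]
    by (simp add: bigon_def merge_plug C'_def m_def p_def q_def smoothing_def crossing_sign_def)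
  \<comment> \<open>With the opposite sign the classical crossings cancel by a Reidemeister II move,
    and so do the factors \<open>inverse \<w>\<close> and \<open>\<w>\<close>.\<close>
  have 2: "B (plug C [([], Cross Over p q, []), ([], Cross Sing q p, [])]) =
      \<w> * B (plug C []) + \<t> * (B (plug C' [([], Cross Over m m, [])]) + \<w> * B (plug C' []))"
    using skein[of Under _ q p, OF _ refl C, of "[([], Cross Over p q, [])]" "[]" "[]" "[]"]
      R2_eq[of Over C, OF _ C] R2_eq[of Over C', OF _ C']
    by (simp add: merge_plug C'_def m_def p_def q_def smoothing_def crossing_sign_def insert_commute)
  have 3: "B (plug C' [([], Cross Over m m, []), ([], Cross Sing m m, [])]) =
      \<w> * (1 + \<t>) * B (plug C' []) + \<t> * B (plug C' [([], Cross Over m m, [])])"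
    using skein_mono[of Under _ m m, OF _ refl C' refl, of "[([], Cross Over m m, [])]" "[]" "[]" "[]"]
      R2_eq[of Over C', OF _ C']
    by (simp add: smoothing_def crossing_sign_def)
  \<comment> \<open>Links the single crossing left by the expansions to the single vertex in the
    claim.\<close>
  have 4: "B (plug C' [([], Cross Sing m m, [])]) =
      inverse \<w> * (1 + inverse \<t>) * B (plug C' [([], Cross Over m m, [])]) + inverse \<t> * B (plug C' [])"
    using skein_mono[of Over _ m m, OF _ refl C' refl, of "[]" "[]" "[]" "[]"]
    by (simp add: smoothing_def crossing_sign_def)
  have "B (plug C (bigon Sing Sing p q)) = B (plug C []) + (\<t> + inverse \<t>) * B (plug C' [])
    + (\<t> + inverse \<t>) * B (plug C' [([], Cross Sing m m, [])])"
    unfolding 1 2 3 4 by (simp add: field_simps)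
  then show ?thesis
    by (simp add: crossing_def merge_plug C'_def m_def p_def q_def)
qed

abbreviation "turn_value \<equiv> \<w> * inverse \<t> / (1 - \<t>) + inverse \<w> * \<t> / (1 - inverse \<t>)"

lemma bigon_antiparallel:
  fixes C d a b
  defines "p \<equiv> (d, a)" and "q \<equiv> (opp d, b)"
  assumes C: "fits C [p, q] [p, q]"
  shows "B (plug C (bigon Sing Sing p q)) = B (plug C [])
    + (\<t> + inverse \<t> + 1) * B (merge {a, b} (plug C []))
    + turn_value * B (merge {a, b} (plug C [([], Cap p, []), ([], Cup p, [])]))"
proof -
  define C' m where "C' = merge_outside {a, b} C" and "m = (d, Min {a, b})"
  have C': "fits C' [m, flip m] [m, flip m]"
    using fits_merge[OF C, of "{a, b}"] by (simp add: C'_def m_def p_def q_def)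
  have d [simp]: "d \<noteq> opp d" "opp d \<noteq> d"
    by (cases d; simp)+
  define T where "T = B (plug C' [([], Cap m, []), ([], Cup m, [])])"
  define L where "L = loop_value * T"
  \<comment> \<open>For antiparallel strands \<open>Under\<close> is the positive crossing, so this
    is (S1); the upper vertex then takes \<open>Over\<close>, hence (S2).\<close>
  have 1: "B (plug C (bigon Sing Sing p q)) =
      inverse \<w> * B (plug C [([], Cross Under p q, []), ([], Cross Sing q p, [])])
      + inverse \<t> * (B (plug C' [([], Cap m, []), ([], Cup (flip m), []), ([], Cross Sing (flip m) m, [])])
        + inverse \<w> * B (plug C' [([], Cross Under m (flip m), []), ([], Cross Sing (flip m) m, [])]))"
    using skein[of Under _ p q, OF _ refl C, of "[]" "[]" "[]" "[([], Cross Sing q p, [])]"]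
    by (simp add: bigon_def merge_plug C'_def m_def p_def q_def smoothing_def crossing_sign_def)
  \<comment> \<open>Smoothing the upper vertex caps off the lower crossing, which becomes a
    removable classical kink.\<close>
  have twist: "B (plug C' [([], Cross Under m (flip m), []), ([], Cap (flip m), []), ([], Cup m, [])]) = T"
    unfolding T_def
    by (rule tequiv_eq[OF _ C'], rule tequiv_step[OF tequiv_twisted_cap_classical[of Under m],
          where e = "[]" and l = "[]" and r = "[]" and f = "[([], Cup m, [])]"]) auto
  have 2: "B (plug C [([], Cross Under p q, []), ([], Cross Sing q p, [])]) =
      \<w> * B (plug C []) + \<t> * (T + \<w> * B (plug C' []))"
    using skein[of Over _ q p, OF _ refl C, of "[([], Cross Under p q, [])]" "[]" "[]" "[]"]
      R2_eq[of Under C, OF _ C] R2_eq[of Under C', OF _ C'] twist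
    by (simp add: merge_plug C'_def m_def p_def q_def smoothing_def crossing_sign_def insert_commute)
  have 3: "B (plug C' [([], Cross Under m (flip m), []), ([], Cross Sing (flip m) m, [])]) =
      \<w> * (1 + \<t>) * B (plug C' []) + \<t> * T"
    using skein_mono[of Over _ "flip m" m, OF _ refl C', of "[([], Cross Under m (flip m), [])]" "[]" "[]" "[]"]
      R2_eq[of Under C', OF _ C'] twist
    by (simp add: smoothing_def crossing_sign_def m_def)
  \<comment> \<open>Smoothing the lower vertex leaves the upper one between the legs of a minimum: a
    singular kink, to which the loop relation applies.\<close>
  have 4: "B (plug C' [([], Cap m, []), ([], Cup (flip m), []), ([], Cross Sing (flip m) m, [])]) =
      L"
  proof -
    let ?C = "sub_outside C' [([], Cap m, []), ([], Cup m, [])] [m] [] []"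
    have "B (plug C' [([], Cap m, []), ([], Cup (flip m), []), ([], Cross Sing (flip m) m, [])]) =
        B (plug ?C (loop_right Sing (flip m)))"
      unfolding plug_sub_outside
      by (rule tequiv_eq[OF _ C'], rule tequiv_step[OF tequiv_twisted_cup[of "flip m" Sing],
          where e = "[([], Cap m, [])]" and l = "[]" and r = "[]" and f = "[]"])
        (auto simp: shift_shift)
    also have "\<dots> = loop_value * B (plug ?C [])"
      by (rule loop_right, rule fits_sub_outside[OF C']) auto
    finally show ?thesis
      by (simp add: plug_sub_outside T_def L_def)
  qed
  \<comment> \<open>The first summand comes from the singular kink, the second from smoothing the
    upper vertex above a classical crossing, once before and once after merging.\<close>
  have "inverse \<t> * loop_value + inverse \<w> * (1 + \<t>) = turn_value"
  proof -
    have "1 - inverse \<t> = (\<t> - 1) / \<t>"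
      by (simp add: field_simps)
    then show ?thesis
      by (simp add: divide_simps) (simp add: algebra_simps)
  qed
  from this[symmetric]
  have turn: "turn_value * T = inverse \<t> * L + inverse \<w> * (1 + \<t>) * T"
    by (simp only: distrib_right mult.assoc L_def)
  have "B (plug C (bigon Sing Sing p q)) = B (plug C [])
      + (\<t> + inverse \<t> + 1) * B (plug C' []) + turn_value * T"
    unfolding 1 2 3 4 turn by (simp add: field_simps)
  then show ?thesis
    by (simp add: merge_plug C'_def m_def p_def q_def T_def)
qed

section \<open>Triangles\<close>

lemma R4_eq:
  assumes "fits C [p, q, r] [r, q, p]"
  shows "B (plug C (triangle_121 Sing Over Over p q r)) = B (plug C (triangle_212 Sing Over Over p q r))"
  by (rule tequiv_eq[OF tequiv_R4_outer assms]) simp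

text \<open>With \<open>p\<close> already over \<open>r\<close>, choosing \<open>Over\<close> for
  \<open>q\<close> and \<open>r\<close> puts \<open>r\<close> below both other strands, so it slides
  under the vertex of \<open>p\<close> and \<open>q\<close>. The triangles without smoothing thus
  cancel in the difference.\<close>

lemma triangle_parallel_over:
  fixes C a b c
  defines "p \<equiv> (Up, a)" and "q \<equiv> (Up, b)" and "r \<equiv> (Up, c)" and "m \<equiv> (Up, Min {a, b, c})"
  assumes C: "fits C [p, q, r] [r, q, p]"
  shows "B (plug C (triangle_121 Sing Over Sing p q r)) - B (plug C (triangle_212 Sing Over Sing p q r)) =
    inverse \<t> * inverse \<t> * (B (plug (merge_outside {a, b, c} C) [([m], Cross Over m m, [])])
      - B (plug (merge_outside {a, b, c} C) [([], Cross Over m m, [m])]))"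
proof -
  define C1 p1 m1 where "C1 = merge_outside {b, c} C"
    and "p1 = (Up, merge_color {b, c} a)" and "m1 = (Up, Min {b, c})"
  have C1: "fits C1 [p1, m1, m1] [m1, m1, p1]"
    using fits_merge[OF C, of "{b, c}"] by (simp add: C1_def p1_def m1_def p_def q_def r_def)
  have merge: "merge {snd p1, snd m1} (plug C1 (merge {b, c} d)) =
      plug (merge_outside {a, b, c} C) (merge {a, b, c} d)" for d
    using merge_merge_plug[of "{b, c}" "{a, b}" C d]
    by (simp add: p1_def m1_def C1_def insert_commute merge_plug[of "{a, b, c}"])
  have 1: "B (plug C (triangle_121 Sing Over Sing p q r)) =
      inverse \<w> * B (plug C (triangle_121 Sing Over Over p q r))
      + inverse \<t> * (B (plug C1 [([], Cross Sing p1 m1, [m1]), ([m1], Cross Over p1 m1, [])])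
        + inverse \<w> * B (plug C1 (triangle_121 Sing Over Over p1 m1 m1)))"
    using skein[of Over _ q r, OF _ refl C, of "[([], Cross Sing p q, [r]), ([q], Cross Over p r, [])]" "[]" "[p]" "[]"]
    by (simp add: triangle_121_def merge_plug C1_def p1_def m1_def p_def q_def r_def
        smoothing_def crossing_sign_def)
  have 2: "B (plug C (triangle_212 Sing Over Sing p q r)) =
      inverse \<w> * B (plug C (triangle_212 Sing Over Over p q r))
      + inverse \<t> * (B (plug C1 [([], Cross Over p1 m1, [m1]), ([m1], Cross Sing p1 m1, [])])
        + inverse \<w> * B (plug C1 (triangle_212 Sing Over Over p1 m1 m1)))"
    using skein[of Over _ q r, OF _ refl C, of "[]" "[p]" "[]" "[([], Cross Over p r, [q]), ([r], Cross Sing p q, [])]"]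
    by (simp add: triangle_212_def merge_plug C1_def p1_def m1_def p_def q_def r_def
        smoothing_def crossing_sign_def)
  \<comment> \<open>Here \<open>p1\<close> passes over two parallel strands. Both expansions below
    contain these terms, merged and unmerged, so only the smoothings survive in the
    difference.\<close>
  let ?XX = "[([], Cross Over p1 m1, [m1]), ([m1], Cross Over p1 m1, [])]"
  have 3: "B (plug C1 [([], Cross Sing p1 m1, [m1]), ([m1], Cross Over p1 m1, [])]) =
      inverse \<w> * B (plug C1 ?XX)
      + inverse \<t> * (B (plug (merge_outside {a, b, c} C) [([m], Cross Over m m, [])])
        + inverse \<w> * B (merge {snd p1, snd m1} (plug C1 ?XX)))"
    using skein[of Over _ p1 m1, OF _ refl C1, of "[]" "[]" "[m1]" "[([m1], Cross Over p1 m1, [])]"]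
      merge[of "[([q], Cross Over p r, [])]"]
    by (simp add: p1_def m1_def p_def q_def r_def m_def smoothing_def crossing_sign_def)
  have 4: "B (plug C1 [([], Cross Over p1 m1, [m1]), ([m1], Cross Sing p1 m1, [])]) =
      inverse \<w> * B (plug C1 ?XX)
      + inverse \<t> * (B (plug (merge_outside {a, b, c} C) [([], Cross Over m m, [m])])
        + inverse \<w> * B (merge {snd p1, snd m1} (plug C1 ?XX)))"
    using skein[of Over _ p1 m1, OF _ refl C1, of "[([], Cross Over p1 m1, [m1])]" "[m1]" "[]" "[]"]
      merge[of "[([], Cross Over p r, [q])]"]
    by (simp add: p1_def m1_def p_def q_def r_def m_def smoothing_def crossing_sign_def)
  show ?thesis
    unfolding 1 2 3 4 R4_eq[OF C] R4_eq[OF C1] by (simp add: algebra_simps)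
qed

lemma triangle_parallel:
  fixes C a b c
  defines "p \<equiv> (Up, a)" and "q \<equiv> (Up, b)" and "r \<equiv> (Up, c)"
  assumes C: "fits C [p, q, r] [r, q, p]"
  shows "B (plug C (triangle_121 Sing Sing Sing p q r)) - B (plug C (triangle_212 Sing Sing Sing p q r)) =
    B (merge {a, b, c} (plug C [([], Cross Sing p q, [r])]))
    - B (merge {a, b, c} (plug C [([p], Cross Sing q r, [])]))"
proof -
  define C2 n q2 where "C2 = merge_outside {a, c} C"
    and "n = (Up, Min {a, c})" and "q2 = (Up, merge_color {a, c} b)"
  define C3 m where "C3 = merge_outside {a, b, c} C" and "m = (Up, Min {a, b, c})"
  have C2: "fits C2 [n, q2, n] [n, q2, n]"
    using fits_merge[OF C, of "{a, c}"] by (simp add: C2_def n_def q2_def p_def q_def r_def)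
  have C3: "fits C3 [m, m, m] [m, m, m]"
    using fits_merge[OF C, of "{a, b, c}"] by (simp add: C3_def m_def p_def q_def r_def)
  have merge: "merge {Min {a, c}, merge_color {a, c} b} (plug C2 (merge {a, c} d)) =
      plug C3 (merge {a, b, c} d)" for d
    using merge_merge_plug[of "{a, c}" "{a, b}" C d]
    by (simp add: C2_def C3_def insert_commute merge_plug[of "{a, b, c}"])
  let ?over = "\<lambda>C p q r. B (plug C (triangle_121 Sing Over Sing p q r))
    - B (plug C (triangle_212 Sing Over Sing p q r))"
  let ?X1 = "B (plug C3 [([], Cross Over m m, [m])])" and ?X2 = "B (plug C3 [([m], Cross Over m m, [])])"
  let ?V1 = "B (plug C3 [([], Cross Sing m m, [m])])" and ?V2 = "B (plug C3 [([m], Cross Sing m m, [])])"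
  \<comment> \<open>Smoothing the crossing of \<open>p\<close> and \<open>r\<close> makes
    \<open>q\<close> cross one strand twice: a bigon, with a free strand on its right here and on
    its left in the other triangle.\<close>
  have 1: "B (plug C (triangle_121 Sing Sing Sing p q r)) =
      inverse \<w> * B (plug C (triangle_121 Sing Over Sing p q r))
      + inverse \<t> * (B (plug C2 (shift [] [n] (bigon Sing Sing n q2)))
        + inverse \<w> * B (plug C2 (triangle_121 Sing Over Sing n q2 n)))"
    using skein[of Over _ p r, OF _ refl C, of "[([], Cross Sing p q, [r])]" "[q]" "[]" "[([], Cross Sing q r, [p])]"]
    by (simp add: triangle_121_def bigon_def merge_plug C2_def n_def q2_def p_def q_def r_def
        smoothing_def crossing_sign_def)
  have 2: "B (plug C (triangle_212 Sing Sing Sing p q r)) =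
      inverse \<w> * B (plug C (triangle_212 Sing Over Sing p q r))
      + inverse \<t> * (B (plug C2 (shift [n] [] (bigon Sing Sing q2 n)))
        + inverse \<w> * B (plug C2 (triangle_212 Sing Over Sing n q2 n)))"
    using skein[of Over _ p r, OF _ refl C, of "[([p], Cross Sing q r, [])]" "[]" "[q]" "[([r], Cross Sing p q, [])]"]
    by (simp add: triangle_212_def bigon_def merge_plug C2_def n_def q2_def p_def q_def r_def
        smoothing_def crossing_sign_def)
  have 3: "B (plug C2 (shift [] [n] (bigon Sing Sing n q2))) =
      B (plug C2 []) + (\<t> + inverse \<t>) * B (plug C3 []) + (\<t> + inverse \<t>) * ?V1"
    using bigon_parallel[of "sub_outside C2 [] [] [n] []" Up "Min {a, c}" "merge_color {a, c} b",
        OF fits_sub_outside[OF C2]] merge[of "[]"] merge[of "[([], Cross Sing p q, [r])]"]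
    by (simp add: plug_sub_outside crossing_def n_def q2_def p_def q_def r_def m_def)
  have 4: "B (plug C2 (shift [n] [] (bigon Sing Sing q2 n))) =
      B (plug C2 []) + (\<t> + inverse \<t>) * B (plug C3 []) + (\<t> + inverse \<t>) * ?V2"
    using bigon_parallel[of "sub_outside C2 [] [n] [] []" Up "merge_color {a, c} b" "Min {a, c}",
        OF fits_sub_outside[OF C2]] merge[of "[]"] merge[of "[([p], Cross Sing q r, [])]"]
    by (simp add: plug_sub_outside crossing_def n_def q2_def p_def q_def r_def m_def insert_commute)
  have 5: "?over C p q r = inverse \<t> * inverse \<t> * (?X2 - ?X1)"
    using triangle_parallel_over[of C a b c] C by (simp add: p_def q_def r_def m_def C3_def)
  \<comment> \<open>The merged triangle gives the same difference, since only diagrams with all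
    three colors identified occur in it.\<close>
  have 6: "?over C2 n q2 n = inverse \<t> * inverse \<t> * (?X2 - ?X1)"
  proof -
    have "B (plug (merge_outside {Min {a, c}, merge_color {a, c} b, Min {a, c}} C2)
        (merge {Min {a, c}, merge_color {a, c} b} (merge {a, c} d))) =
      B (plug C3 (merge {a, b, c} d))" for d
      using merge[of d] by (simp add: merge_plug insert_commute)
    from this[of "[([], Cross Over p q, [r])]"] this[of "[([p], Cross Over q r, [])]"]
    show ?thesis
      using triangle_parallel_over[of C2 "Min {a, c}" "merge_color {a, c} b" "Min {a, c}"] C2
      by (simp add: n_def q2_def p_def q_def r_def m_def insert_commute)
  qed
  \<comment> \<open>The smoothed terms of \<open>?V1\<close> and \<open>?V2\<close> agree, so
    \<open>?V1 - ?V2\<close> is a multiple of \<open>?X1 - ?X2\<close>, and crossings can be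
    expressed by vertices again.\<close>
  have 7: "?V1 = inverse \<w> * (1 + inverse \<t>) * ?X1 + inverse \<t> * B (plug C3 [])"
    using skein_mono[of Over _ m m, OF _ refl C3 refl, of "[]" "[]" "[m]" "[]"]
    by (simp add: smoothing_def crossing_sign_def)
  have 8: "?V2 = inverse \<w> * (1 + inverse \<t>) * ?X2 + inverse \<t> * B (plug C3 [])"
    using skein_mono[of Over _ m m, OF _ refl C3 refl, of "[]" "[m]" "[]" "[]"]
    by (simp add: smoothing_def crossing_sign_def)
  have cancel: "\<t> * (inverse \<t> * z) = z" for z
    by (simp flip: mult.assoc)
  have "B (plug C (triangle_121 Sing Sing Sing p q r)) - B (plug C (triangle_212 Sing Sing Sing p q r)) =
      inverse \<w> * ?over C p q r
      + inverse \<t> * ((\<t> + inverse \<t>) * (?V1 - ?V2) + inverse \<w> * ?over C2 n q2 n)"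
    unfolding 1 2 3 4 by (simp add: algebra_simps)
  also have "\<dots> = inverse \<t> * (\<t> + inverse \<t>) * (?V1 - ?V2)
      - inverse \<t> * inverse \<t> * (inverse \<w> * (1 + inverse \<t>) * (?X1 - ?X2))"
    unfolding 5 6 by (simp add: algebra_simps cancel)
  also have "inverse \<w> * (1 + inverse \<t>) * (?X1 - ?X2) = ?V1 - ?V2"
    unfolding 7 8 by (simp add: algebra_simps)
  also have "inverse \<t> * (\<t> + inverse \<t>) * (?V1 - ?V2) - inverse \<t> * inverse \<t> * (?V1 - ?V2) = ?V1 - ?V2"
    by (simp add: algebra_simps cancel)
  finally show ?thesis
    by (simp add: merge_plug C3_def m_def p_def q_def r_def)
qed

text \<open>As for upward strands, \<open>r\<close> slides under the vertex of \<open>p\<close> and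
  \<open>q\<close>. Since \<open>q\<close> runs downward, its \<open>Over\<close> crossings are
  negative, whence the factor \<open>\<t> * \<t>\<close>.\<close>

lemma triangle_antiparallel_over:
  fixes C a b c
  defines "p \<equiv> (Up, a)" and "q \<equiv> (Down, b)" and "r \<equiv> (Up, c)" and "m \<equiv> (Up, Min {a, b, c})"
  assumes C: "fits C [p, q, r] [r, q, p]"
  shows "B (plug C (triangle_121 Sing Over Sing p q r)) - B (plug C (triangle_212 Sing Over Sing p q r)) =
    \<t> * \<t> * (B (plug (merge_outside {a, b, c} C) [([], Cap m, [m]), ([], Cup m, [m])])
      - B (plug (merge_outside {a, b, c} C) [([m], Cap (flip m), []), ([m], Cup (flip m), [])]))"
proof -
  define C1 p1 m1 where "C1 = merge_outside {b, c} C"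
    and "p1 = (Up, merge_color {b, c} a)" and "m1 = (Up, Min {b, c})"
  define C3 where "C3 = merge_outside {a, b, c} C"
  have C1: "fits C1 [p1, flip m1, m1] [m1, flip m1, p1]"
    using fits_merge[OF C, of "{b, c}"] by (simp add: C1_def p1_def m1_def p_def q_def r_def)
  have C3: "fits C3 [m, flip m, m] [m, flip m, m]"
    using fits_merge[OF C, of "{a, b, c}"] by (simp add: C3_def m_def p_def q_def r_def)
  have merge: "merge {snd p1, snd m1} (plug C1 (merge {b, c} d)) =
      plug C3 (merge {a, b, c} d)" for d
    using merge_merge_plug[of "{b, c}" "{a, b}" C d]
    by (simp add: p1_def m1_def C1_def C3_def insert_commute merge_plug[of "{a, b, c}"])
  \<comment> \<open>After smoothing the crossing of \<open>q\<close> and \<open>r\<close>, the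
    strand \<open>p\<close> crosses both legs of a maximum or of a minimum. For
    \<open>k = Over\<close> it can be pulled off, to the same diagram \<open>?S\<close> in both
    cases, which cancels in the difference.\<close>
  let ?cap = "\<lambda>p1 m1 k. [([], Cross k p1 (flip m1), [m1]), ([flip m1], Cross Over p1 m1, []),
      ([], Cap (flip m1), [p1]), ([], Cup m1, [p1])]"
  let ?cup = "\<lambda>p1 m1 k. [([p1], Cap (flip m1), []), ([p1], Cup m1, []),
      ([], Cross Over p1 m1, [flip m1]), ([m1], Cross k p1 (flip m1), [])]"
  let ?S = "\<lambda>p1 m1. [([p1], Cap (flip m1), []), ([], Cup m1, [p1])]"
  have 1: "B (plug C (triangle_121 Sing Over Sing p q r)) =
      \<w> * B (plug C (triangle_121 Sing Over Over p q r))
      + \<t> * (B (plug C1 (?cap p1 m1 Sing))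
        + \<w> * B (plug C1 (triangle_121 Sing Over Over p1 (flip m1) m1)))"
    using skein[of Over _ q r, OF _ refl C, of "[([], Cross Sing p q, [r]), ([q], Cross Over p r, [])]" "[]" "[p]" "[]"]
    by (simp add: triangle_121_def merge_plug C1_def p1_def m1_def p_def q_def r_def
        smoothing_def crossing_sign_def)
  have 2: "B (plug C (triangle_212 Sing Over Sing p q r)) =
      \<w> * B (plug C (triangle_212 Sing Over Over p q r))
      + \<t> * (B (plug C1 (?cup p1 m1 Sing))
        + \<w> * B (plug C1 (triangle_212 Sing Over Over p1 (flip m1) m1)))"
    using skein[of Over _ q r, OF _ refl C, of "[]" "[p]" "[]" "[([], Cross Over p r, [q]), ([r], Cross Sing p q, [])]"]
    by (simp add: triangle_212_def merge_plug C1_def p1_def m1_def p_def q_def r_def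
        smoothing_def crossing_sign_def)
  have cap: "tequiv [p1, flip m1, m1] [m1, flip m1, p1] (?cap p1 m1 Over) (?S p1 m1)" for p1 m1
    by (rule tequiv_step[OF tequiv_over_cap[of Over p1 "flip m1"],
          where e = "[]" and l = "[]" and r = "[]" and f = "[([], Cup m1, [p1])]"]) auto
  have cup: "tequiv [p1, flip m1, m1] [m1, flip m1, p1] (?cup p1 m1 Over) (?S p1 m1)" for p1 m1
    by (rule tequiv_step[OF tequiv_over_cup[of Over p1 m1],
          where e = "[([p1], Cap (flip m1), [])]" and l = "[]" and r = "[]" and f = "[]"]) auto
  let ?m = "merge {snd p1, snd m1}"
  have 3: "B (plug C1 (?cap p1 m1 Sing)) = \<w> * B (plug C1 (?S p1 m1))
      + \<t> * (B (plug C3 [([], Cap m, [m]), ([], Cup m, [m])]) + \<w> * B (?m (plug C1 (?S p1 m1))))"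
  proof -
    \<comment> \<open>Smoothing the vertex on one leg turns the crossing with the other leg into a
      classical kink.\<close>
    have "B (plug C3 [([], Cap m, [m]), ([], Cup (flip m), [m]), ([flip m], Cross Over m m, []),
          ([], Cap (flip m), [m]), ([], Cup m, [m])]) =
        B (plug C3 [([], Cap m, [m]), ([], Cup m, [m])])"
      by (rule tequiv_eq[OF _ C3], rule tequiv_step[OF tequiv_R1_left[of Over m],
          where e = "[([], Cap m, [m])]" and l = "[]" and r = "[]" and f = "[([], Cup m, [m])]"])
        (auto simp: loop_left_def)
    moreover have "B (?m (plug C1 (?cap p1 m1 Over))) = B (?m (plug C1 (?S p1 m1)))"
      by (rule tequiv_merge_eq[OF _ C1])
        (use cap[of "apsnd (merge_color {snd p1, snd m1}) p1" "apsnd (merge_color {snd p1, snd m1}) m1"] in simp)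
    ultimately show ?thesis
      using skein[of Over _ p1 "flip m1", OF _ refl C1, of "[]" "[]" "[m1]"
          "[([flip m1], Cross Over p1 m1, []), ([], Cap (flip m1), [p1]), ([], Cup m1, [p1])]"]
        merge[of "[([], Cap p, [r]), ([], Cup (flip p), [r]), ([q], Cross Over p r, []),
          ([], Cap q, [p]), ([], Cup r, [p])]"]
        tequiv_eq[OF cap C1]
      by (simp add: p1_def m1_def p_def q_def r_def m_def smoothing_def crossing_sign_def)
  qed
  have 4: "B (plug C1 (?cup p1 m1 Sing)) = \<w> * B (plug C1 (?S p1 m1))
      + \<t> * (B (plug C3 [([m], Cap (flip m), []), ([m], Cup (flip m), [])]) + \<w> * B (?m (plug C1 (?S p1 m1))))"
  proof -
    have "B (plug C3 [([m], Cap (flip m), []), ([m], Cup m, []), ([], Cross Over m m, [flip m]),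
          ([m], Cap m, []), ([m], Cup (flip m), [])]) =
        B (plug C3 [([m], Cap (flip m), []), ([m], Cup (flip m), [])])"
      by (rule tequiv_eq[OF _ C3], rule tequiv_step[OF tequiv_R1_right[of Over m],
          where e = "[([m], Cap (flip m), [])]" and l = "[]" and r = "[]" and f = "[([m], Cup (flip m), [])]"])
        (auto simp: loop_right_def)
    moreover have "B (?m (plug C1 (?cup p1 m1 Over))) = B (?m (plug C1 (?S p1 m1)))"
      by (rule tequiv_merge_eq[OF _ C1])
        (use cup[of "apsnd (merge_color {snd p1, snd m1}) p1" "apsnd (merge_color {snd p1, snd m1}) m1"] in simp)
    ultimately show ?thesis
      using skein[of Over _ p1 "flip m1", OF _ refl C1, of
          "[([p1], Cap (flip m1), []), ([p1], Cup m1, []), ([], Cross Over p1 m1, [flip m1])]" "[m1]" "[]" "[]"]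
        merge[of "[([p], Cap q, []), ([p], Cup r, []), ([], Cross Over p r, [q]),
          ([r], Cap p, []), ([r], Cup (flip p), [])]"]
        tequiv_eq[OF cup C1]
      by (simp add: p1_def m1_def p_def q_def r_def m_def smoothing_def crossing_sign_def)
  qed
  show ?thesis
    unfolding 1 2 3 4 R4_eq[OF C] R4_eq[OF C1] C3_def[symmetric] by (simp add: algebra_simps)
qed

text \<open>The expansion of the upward triangle carries over. The bigons that remain are
  antiparallel; their turned-back terms are \<open>?E1\<close> and \<open>?E2\<close>, and their
  other terms cancel between the two triangles.\<close>

lemma triangle_antiparallel:
  fixes C a b c
  defines "p \<equiv> (Up, a)" and "q \<equiv> (Down, b)" and "r \<equiv> (Up, c)"
  assumes C: "fits C [p, q, r] [r, q, p]"
  shows "B (plug C (triangle_121 Sing Sing Sing p q r)) - B (plug C (triangle_212 Sing Sing Sing p q r)) =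
    (\<w> * inverse (\<t>\<^sup>2) / (1 - \<t>) + inverse \<w> * \<t>\<^sup>2 / (1 - inverse \<t>)) *
    (B (merge {a, b, c} (plug C [([], Cap p, [r]), ([], Cup p, [r])]))
     - B (merge {a, b, c} (plug C [([p], Cap q, []), ([p], Cup q, [])])))"
proof -
  define C2 n q2 where "C2 = merge_outside {a, c} C"
    and "n = (Up, Min {a, c})" and "q2 = (Down, merge_color {a, c} b)"
  define C3 m where "C3 = merge_outside {a, b, c} C" and "m = (Up, Min {a, b, c})"
  have C2: "fits C2 [n, q2, n] [n, q2, n]"
    using fits_merge[OF C, of "{a, c}"] by (simp add: C2_def n_def q2_def p_def q_def r_def)
  have merge: "merge {Min {a, c}, merge_color {a, c} b} (plug C2 (merge {a, c} d)) =
      plug C3 (merge {a, b, c} d)" for d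
    using merge_merge_plug[of "{a, c}" "{a, b}" C d]
    by (simp add: C2_def C3_def insert_commute merge_plug[of "{a, b, c}"])
  let ?over = "\<lambda>C p q r. B (plug C (triangle_121 Sing Over Sing p q r))
    - B (plug C (triangle_212 Sing Over Sing p q r))"
  let ?E1 = "B (plug C3 [([], Cap m, [m]), ([], Cup m, [m])])"
  let ?E2 = "B (plug C3 [([m], Cap (flip m), []), ([m], Cup (flip m), [])])"
  have 1: "B (plug C (triangle_121 Sing Sing Sing p q r)) =
      inverse \<w> * B (plug C (triangle_121 Sing Over Sing p q r))
      + inverse \<t> * (B (plug C2 (shift [] [n] (bigon Sing Sing n q2)))
        + inverse \<w> * B (plug C2 (triangle_121 Sing Over Sing n q2 n)))"
    using skein[of Over _ p r, OF _ refl C, of "[([], Cross Sing p q, [r])]" "[q]" "[]" "[([], Cross Sing q r, [p])]"]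
    by (simp add: triangle_121_def bigon_def merge_plug C2_def n_def q2_def p_def q_def r_def
        smoothing_def crossing_sign_def)
  have 2: "B (plug C (triangle_212 Sing Sing Sing p q r)) =
      inverse \<w> * B (plug C (triangle_212 Sing Over Sing p q r))
      + inverse \<t> * (B (plug C2 (shift [n] [] (bigon Sing Sing q2 n)))
        + inverse \<w> * B (plug C2 (triangle_212 Sing Over Sing n q2 n)))"
    using skein[of Over _ p r, OF _ refl C, of "[([p], Cross Sing q r, [])]" "[]" "[q]" "[([r], Cross Sing p q, [])]"]
    by (simp add: triangle_212_def bigon_def merge_plug C2_def n_def q2_def p_def q_def r_def
        smoothing_def crossing_sign_def)
  have 3: "B (plug C2 (shift [] [n] (bigon Sing Sing n q2))) =
      B (plug C2 []) + (\<t> + inverse \<t> + 1) * B (plug C3 []) + turn_value * ?E1"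
    using bigon_antiparallel[of "sub_outside C2 [] [] [n] []" Up "Min {a, c}" "merge_color {a, c} b",
        OF fits_sub_outside[OF C2]] merge[of "[]"] merge[of "[([], Cap p, [r]), ([], Cup p, [r])]"]
    by (simp add: plug_sub_outside crossing_def n_def q2_def p_def q_def r_def m_def)
  have 4: "B (plug C2 (shift [n] [] (bigon Sing Sing q2 n))) =
      B (plug C2 []) + (\<t> + inverse \<t> + 1) * B (plug C3 []) + turn_value * ?E2"
    using bigon_antiparallel[of "sub_outside C2 [] [n] [] []" Down "merge_color {a, c} b" "Min {a, c}",
        OF fits_sub_outside[OF C2]] merge[of "[]"] merge[of "[([p], Cap q, []), ([p], Cup q, [])]"]
    by (simp add: plug_sub_outside crossing_def n_def q2_def p_def q_def r_def m_def insert_commute)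
  have 5: "?over C p q r = \<t> * \<t> * (?E1 - ?E2)"
    using triangle_antiparallel_over[of C a b c] C by (simp add: p_def q_def r_def m_def C3_def)
  have 6: "?over C2 n q2 n = \<t> * \<t> * (?E1 - ?E2)"
  proof -
    have "B (plug (merge_outside {Min {a, c}, merge_color {a, c} b, Min {a, c}} C2)
        (merge {Min {a, c}, merge_color {a, c} b} (merge {a, c} d))) =
      B (plug C3 (merge {a, b, c} d))" for d
      using merge[of d] by (simp add: merge_plug insert_commute)
    from this[of "[([], Cap p, [r]), ([], Cup p, [r])]"] this[of "[([p], Cap q, []), ([p], Cup q, [])]"]
    show ?thesis
      using triangle_antiparallel_over[of C2 "Min {a, c}" "merge_color {a, c} b" "Min {a, c}"] C2
      by (simp add: n_def q2_def p_def q_def r_def m_def insert_commute)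
  qed
  \<comment> \<open>On the right, the first summand is contributed by the bigons, the second by the
    two differences of triangles with an \<open>Over\<close> crossing, unmerged and merged.\<close>
  have coeff: "\<w> * inverse (\<t>\<^sup>2) / (1 - \<t>) + inverse \<w> * \<t>\<^sup>2 / (1 - inverse \<t>) =
      inverse \<t> * turn_value + inverse \<w> * (1 + inverse \<t>) * (\<t> * \<t>)"
  proof -
    have "1 - inverse \<t> = (\<t> - 1) / \<t>"
      by (simp add: field_simps)
    then show ?thesis
      by (simp add: divide_simps power2_eq_square) (simp add: algebra_simps)
  qed
  have "B (plug C (triangle_121 Sing Sing Sing p q r)) - B (plug C (triangle_212 Sing Sing Sing p q r)) =
      inverse \<w> * ?over C p q r + inverse \<t> * (turn_value * (?E1 - ?E2) + inverse \<w> * ?over C2 n q2 n)"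
    unfolding 1 2 3 4 by (simp add: algebra_simps)
  also have "\<dots> = (inverse \<t> * turn_value + inverse \<w> * (1 + inverse \<t>) * (\<t> * \<t>)) * (?E1 - ?E2)"
    unfolding 5 6 by (simp add: algebra_simps)
  finally show ?thesis
    unfolding coeff[symmetric] by (simp add: merge_plug C3_def m_def p_def q_def r_def)
qed

end

section \<open>The five relations for the bracket\<close>

theorem theorem3:
  fixes F B :: "diagram \<Rightarrow> ratfun"
  assumes "AJ_invariant F" and "singular_extension F B"
  shows "
    (\<forall>C d a. \<forall>G \<in> {plug C (loop_right Sing (d, a)), plug C (loop_left Sing (d, a))}.
       link_diagram G \<longrightarrow>
       B G = (\<w> / (1 - \<t>) + inverse \<w> / (1 - inverse \<t>)) * B (plug C [])) \<and>
    (\<forall>C a b. let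
         G = plug C (bigon Sing Sing (Up, a) (Up, b));
         G_par = plug C [];
         G_vert = plug C (crossing Sing (Up, a) (Up, b))
       in link_diagram G \<longrightarrow>
       B G = B G_par + (\<t> + inverse \<t>) * B (merge {a, b} G_par)
             + (\<t> + inverse \<t>) * B (merge {a, b} G_vert)) \<and>
    (\<forall>C d a b. let
         G = plug C (bigon Sing Sing (d, a) (opp d, b));
         G_par = plug C [];
         G_turn = plug C [([], Cap (d, a), []), ([], Cup (d, a), [])]
       in link_diagram G \<longrightarrow>
       B G = B G_par + (\<t> + inverse \<t> + 1) * B (merge {a, b} G_par)
             + (\<w> * inverse \<t> / (1 - \<t>) + inverse \<w> * \<t> / (1 - inverse \<t>))
               * B (merge {a, b} G_turn)) \<and>
    (\<forall>C a b c. let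
         G121 = plug C (triangle_121 Sing Sing Sing (Up, a) (Up, b) (Up, c));
         G212 = plug C (triangle_212 Sing Sing Sing (Up, a) (Up, b) (Up, c));
         G1 = plug C [([], Cross Sing (Up, a) (Up, b), [(Up, c)])];
         G2 = plug C [([(Up, a)], Cross Sing (Up, b) (Up, c), [])]
       in link_diagram G121 \<longrightarrow>
       B G121 - B G212 = B (merge {a, b, c} G1) - B (merge {a, b, c} G2)) \<and>
    (\<forall>C a b c. let
         H121 = plug C (triangle_121 Sing Sing Sing (Up, a) (Down, b) (Up, c));
         H212 = plug C (triangle_212 Sing Sing Sing (Up, a) (Down, b) (Up, c));
         E1 = plug C [([], Cap (Up, a), [(Up, c)]), ([], Cup (Up, a), [(Up, c)])];
         E2 = plug C [([(Up, a)], Cap (Down, b), []), ([(Up, a)], Cup (Down, b), [])]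
       in link_diagram H121 \<longrightarrow>
       B H121 - B H212 =
         (\<w> * inverse (\<t>\<^sup>2) / (1 - \<t>) + inverse \<w> * \<t>\<^sup>2 / (1 - inverse \<t>))
         * (B (merge {a, b, c} E1) - B (merge {a, b, c} E2)))"
proof -
  interpret singular_skein B
  proof
    show "B D = B D'" if "link_diagram D" "link_diagram D'" "isotopic D D'" for D D'
      using assms(2) that by (simp add: singular_extension_def isotopy_invariant_def)
  next
    fix k C a b
    assume "k \<noteq> Sing" "link_diagram (plug C (crossing Sing (Up, a) (Up, b)))"
    moreover from this(2) have "B (plug C (crossing Sing (Up, a) (Up, b))) =
        1 / \<w> * B (plug C (crossing Over (Up, a) (Up, b))) + 1 / \<t> * B (merge {a, b} (plug C []))
        + 1 / (\<t> * \<w>) * B (merge {a, b} (plug C (crossing Over (Up, a) (Up, b)))) \<and>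
      B (plug C (crossing Sing (Up, a) (Up, b))) =
        \<w> * B (plug C (crossing Under (Up, a) (Up, b))) + \<t> * B (merge {a, b} (plug C []))
        + \<t> * \<w> * B (merge {a, b} (plug C (crossing Under (Up, a) (Up, b))))"
      using assms(2) unfolding singular_extension_def Let_def by blast
    ultimately show "B (plug C (crossing Sing (Up, a) (Up, b))) =
        coeff_w k * B (plug C (crossing k (Up, a) (Up, b)))
        + coeff_t k * (B (merge {a, b} (plug C []))
          + coeff_w k * B (merge {a, b} (plug C (crossing k (Up, a) (Up, b)))))"
      by (cases k) (simp_all add: divide_inverse distrib_left mult.assoc)
  qed
  \<comment> \<open>Nonempty contents with nonempty boundary fix the end points of the disk, so
    being a link diagram yields an outside that fits, for both sides of a relation at once.\<close>
  have loop: "fits C [(d, a)] [(d, a)]"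
    if "link_diagram (plug C (loop_right Sing (d, a))) \<or> link_diagram (plug C (loop_left Sing (d, a)))" for C d a
    using that by (auto elim!: fits_plug simp: loop_right_def loop_left_def)
  have bigon: "fits C [p, q] [p, q]" if "link_diagram (plug C (bigon Sing Sing p q))" for C p q
    by (rule fits_plug[OF that]) (simp_all add: bigon_def)
  have triangle: "fits C [p, q, r] [r, q, p]"
    if "link_diagram (plug C (triangle_121 Sing Sing Sing p q r))" for C p q r
    by (rule fits_plug[OF that]) (simp_all add: triangle_121_def)
  show ?thesis
    unfolding Let_def
    using loop_right[OF loop] loop_left[OF loop]
      bigon_parallel[OF bigon] bigon_antiparallel[OF bigon]
      triangle_parallel[OF triangle] triangle_antiparallel[OF triangle]
    by auto
qed

end
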